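(* Let $T$ be a tree. Then $\mathrm{pthin}(T)=2$ if and only if $T$ has at least one vertex of degree at least $3$ and $T$ contains no induced subgraph isomorphic to any tree in the families $T_0$, $T_1$, $T_2^{i,j,k}$ ($i,j,k\ge 2$), $T_3^{i,j}$ ($i,j\ge 2$), $T_4^{i}$ ($i\ge 2$), $T_5^{i,j}$ ($i,j\ge 1$) defined in the context.
   Context: For a graph $G=(V,E)$, a linear ordering $<$ of $V$ and a partition of $V$ into classes are called strongly consistent if for every triple $r<s<t$ of vertices with $rt\in E$: if $r$ and $s$ belong to the same class then $st\in E$, and if $s$ and $t$ belong to the same class then $rs\in E$. The proper thinness $\mathrm{pthin}(G)$ is the minimum $k$ such that some ordering of $V$ and some partition of $V$ into $k$ classes are strongly consistent. Say that a vertex $x$ "carries $m$ pendant leaves" if $m$ new vertices of degree $1$ are attached to $x$. The trees are (each consisting exactly of the listed vertices and edges): $T_0$: a vertex $c$ with five neighbors $a_1,\dots,a_5$, each $a_\ell$ carrying one pendant leaf (the subdivided star $K_{1,5}$, 11 vertices). $T_1$: a vertex $c$ with three neighbors $x,y,z$, each carrying three pendant leaves (13 vertices). $T_2^{i,j,k}$: a vertex $c$ and three paths from $c$ of lengths $i,j,k\ge 2$, pairwise sharing only $c$, ending at $x,y,z$ respectively; each of $x,y,z$ carries two pendant leaves. $T_3^{i,j}$: a vertex $c$ adjacent to a vertex $u$ carrying three pendant leaves, plus two paths from $c$ of lengths $i,j\ge 2$, sharing only $c$ (and disjoint from $u$), ending at $x,y$; each of $x,y$ carries two pendant leaves. $T_4^{i}$: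 a vertex $c$ adjacent to two vertices $u,u'$ each carrying three pendant leaves, plus a path from $c$ of length $i\ge2$ (disjoint from $u,u'$) ending at $x$, which carries two pendant leaves. $T_5^{i,j}$: a vertex $c$ adjacent to a leaf $\ell$ and to a vertex $w$ carrying two pendant leaves, plus two paths from $c$ of lengths $i,j\ge 1$, sharing only $c$ (and disjoint from $\ell,w$), ending at $x,y$; each of $x,y$ carries two pendant leaves. *)

theory Defs
  imports Main
begin

definition simple_graph :: "'a set \<Rightarrow> ('a \<Rightarrow> 'a \<Rightarrow> bool) \<Rightarrow> bool" where
  "simple_graph V E \<longleftrightarrow> finite V \<and>
     (\<forall>u v. E u v \<longrightarrow> u \<in> V \<and> v \<in> V) \<and>
     (\<forall>u v. E u v \<longrightarrow> E v u) \<and> (\<forall>u. \<not> E u u)"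

definition connected_graph :: "'a set \<Rightarrow> ('a \<Rightarrow> 'a \<Rightarrow> bool) \<Rightarrow> bool" where
  "connected_graph V E \<longleftrightarrow> (\<forall>u\<in>V. \<forall>v\<in>V. E\<^sup>*\<^sup>* u v)"

definition is_cycle :: "'a set \<Rightarrow> ('a \<Rightarrow> 'a \<Rightarrow> bool) \<Rightarrow> 'a list \<Rightarrow> bool" where
  "is_cycle V E cs \<longleftrightarrow> length cs \<ge> 3 \<and> distinct cs \<and> set cs \<subseteq> V \<and>
     (\<forall>i. Suc i < length cs \<longrightarrow> E (cs ! i) (cs ! Suc i)) \<and> E (last cs) (hd cs)"

definition acyclic_graph :: "'a set \<Rightarrow> ('a \<Rightarrow> 'a \<Rightarrow> bool) \<Rightarrow> bool" where
  "acyclic_graph V E \<longleftrightarrow> \<not> (\<exists>cs. is_cycle V E cs)"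

definition is_tree :: "'a set \<Rightarrow> ('a \<Rightarrow> 'a \<Rightarrow> bool) \<Rightarrow> bool" where
  "is_tree V E \<longleftrightarrow> simple_graph V E \<and> V \<noteq> {} \<and> connected_graph V E \<and> acyclic_graph V E"

definition degree :: "'a set \<Rightarrow> ('a \<Rightarrow> 'a \<Rightarrow> bool) \<Rightarrow> 'a \<Rightarrow> nat" where
  "degree V E v = card {u \<in> V. E v u}"

definition has_induced :: "'a set \<Rightarrow> ('a \<Rightarrow> 'a \<Rightarrow> bool) \<Rightarrow> 'b set \<Rightarrow> ('b \<Rightarrow> 'b \<Rightarrow> bool) \<Rightarrow> bool" where
  "has_induced V E W F \<longleftrightarrow> (\<exists>\<phi>. inj_on \<phi> W \<and> \<phi> ` W \<subseteq> V \<and>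
      (\<forall>u\<in>W. \<forall>v\<in>W. F u v \<longleftrightarrow> E (\<phi> u) (\<phi> v)))"

text \<open>The linear ordering of V is given by an injective map ord : V -> nat
  (r < s iff ord r < ord s); the partition by a class map cls.\<close>
definition strongly_consistent ::
  "'a set \<Rightarrow> ('a \<Rightarrow> 'a \<Rightarrow> bool) \<Rightarrow> ('a \<Rightarrow> nat) \<Rightarrow> ('a \<Rightarrow> nat) \<Rightarrow> bool" where
  "strongly_consistent V E ord cls \<longleftrightarrow>
     (\<forall>r\<in>V. \<forall>s\<in>V. \<forall>t\<in>V. ord r < ord s \<and> ord s < ord t \<and> E r t \<longrightarrow>
        (cls r = cls s \<longrightarrow> E s t) \<and> (cls s = cls t \<longrightarrow> E r s))"

definition pthin :: "'a set \<Rightarrow> ('a \<Rightarrow> 'a \<Rightarrow> bool) \<Rightarrow> nat" where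
  "pthin V E = (LEAST k. \<exists>ord cls. inj_on ord V \<and> cls ` V \<subseteq> {..<k} \<and>
                     strongly_consistent V E ord cls)"

text \<open>spider bs: a centre c = (0,0,0); for each branch b < length bs with
  bs ! b = (len, m) a path c - (b+1,1,0) - ... - (b+1,len,0) of length len,
  whose end (b+1,len,0) carries m pendant leaves (b+1,len,l), 1 <= l <= m.\<close>

definition spider_V :: "(nat \<times> nat) list \<Rightarrow> (nat \<times> nat \<times> nat) set" where
  "spider_V bs = {(0,0,0)} \<union>
     {(Suc b, d, 0) | b d. b < length bs \<and> 1 \<le> d \<and> d \<le> fst (bs ! b)} \<union>
     {(Suc b, fst (bs ! b), l) | b l. b < length bs \<and> 1 \<le> l \<and> l \<le> snd (bs ! b)}"

definition spider_E0 :: "(nat \<times> nat) list \<Rightarrow> nat \<times> nat \<times> nat \<Rightarrow> nat \<times> nat \<times> nat \<Rightarrow> bool" where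
  "spider_E0 bs u v \<longleftrightarrow>
     (\<exists>b. b < length bs \<and> 1 \<le> fst (bs ! b) \<and> u = (0,0,0) \<and> v = (Suc b, 1, 0)) \<or>
     (\<exists>b d. b < length bs \<and> 1 \<le> d \<and> d < fst (bs ! b) \<and> u = (Suc b, d, 0) \<and> v = (Suc b, Suc d, 0)) \<or>
     (\<exists>b l. b < length bs \<and> 1 \<le> l \<and> l \<le> snd (bs ! b) \<and>
        u = (Suc b, fst (bs ! b), 0) \<and> v = (Suc b, fst (bs ! b), l))"

definition spider_E :: "(nat \<times> nat) list \<Rightarrow> nat \<times> nat \<times> nat \<Rightarrow> nat \<times> nat \<times> nat \<Rightarrow> bool" where
  "spider_E bs u v \<longleftrightarrow> spider_E0 bs u v \<or> spider_E0 bs v u"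

abbreviation has_spider :: "'a set \<Rightarrow> ('a \<Rightarrow> 'a \<Rightarrow> bool) \<Rightarrow> (nat \<times> nat) list \<Rightarrow> bool" where
  "has_spider V E bs \<equiv> has_induced V E (spider_V bs) (spider_E bs)"

definition T0 :: "(nat \<times> nat) list" where "T0 = replicate 5 (1,1)"
definition T1 :: "(nat \<times> nat) list" where "T1 = replicate 3 (1,3)"
definition T2 :: "nat \<Rightarrow> nat \<Rightarrow> nat \<Rightarrow> (nat \<times> nat) list" where "T2 i j k = [(i,2),(j,2),(k,2)]"
definition T3 :: "nat \<Rightarrow> nat \<Rightarrow> (nat \<times> nat) list" where "T3 i j = [(1,3),(i,2),(j,2)]"
definition T4 :: "nat \<Rightarrow> (nat \<times> nat) list" where "T4 i = [(1,3),(1,3),(i,2)]"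
definition T5 :: "nat \<Rightarrow> nat \<Rightarrow> (nat \<times> nat) list" where "T5 i j = [(1,0),(1,2),(i,2),(j,2)]"

end

theory Submission
  imports Defs
begin

text \<open>In a strongly consistent ordering of a tree with two classes, adjacent vertices of one class
  are consecutive in it, the neighbours of a vertex in the other class are consecutive there, and
  edges between the classes do not cross. So a vertex has at most four non-leaf neighbours: one on
  either side in its own class, and the two extreme ones in the other class. A branch that runs
  along a class can only branch at an edge between the classes; two such branches running in the same
  direction from the two ends of such an edge would close a cycle.
  This bounds the number of large branches at a vertex, which excludes the spiders.

  Conversely, call a branch medium or heavy according to the legs of the spiders.
  Without the spiders, every vertex has at most two heavy branches, and at most two medium ones if
  its degree is at least four. A suitable first edge is then extended in both directions to a path, the
  spine, always entering the largest remaining branch. The spine is one class, in the order of the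
  path. What hangs off a vertex of the spine are bare paths, at most two of them longer than one
  vertex, or a single fork; these are listed next to that vertex.\<close>

section \<open>Bridges and branches of a tree\<close>

text \<open>Both directions pass through three local conditions, the axioms of
  \<open>sparse_tree\<close>: at most four non-leaf neighbours, at most two heavy branches, and
  three medium branches only at a vertex of degree exactly 3. The families are what violates them. A
  heavy leg has length 1 and three leaves, or length at least 2 and two leaves; \<open>T1\<close>,
  \<open>T4\<close>, \<open>T3\<close>, \<open>T2\<close> are the triples with three, two, one, none
  of the first kind. Three medium branches and a fourth neighbour give \<open>T5\<close> if some leg
  has length 1 and \<open>T2\<close> otherwise; \<open>T0\<close> is five non-leaf neighbours. The
  number 4 counts the places for a non-leaf neighbour: left or right in the same class, leftmost or
  rightmost in the other one. Legs are walks instead of embedded paths because in a tree a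
  non-backtracking walk never returns, so legs with distinct first steps always assemble into an
  induced spider. The construction must control the vertices lying between the two ends of an edge.
  The blocks of the spine are listed so that a single edge joins consecutive ones and everything
  strictly between its ends is outside the class of the spine.\<close>

definition del_edge :: "('a \<Rightarrow> 'a \<Rightarrow> bool) \<Rightarrow> 'a \<Rightarrow> 'a \<Rightarrow> 'a \<Rightarrow> 'a \<Rightarrow> bool" where
  "del_edge E x y = (\<lambda>a b. E a b \<and> {a, b} \<noteq> {x, y})"

lemma rtranclp_distinct_path:
  assumes "R\<^sup>*\<^sup>* x y"
  shows "\<exists>p. p \<noteq> [] \<and> hd p = x \<and> last p = y \<and> distinct p \<and> successively R p"
  using assms
proof (induction rule: rtranclp_induct)
  case base
  then show ?case by (intro exI[of _ "[x]"]) auto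
next
  case (step y z)
  then obtain p where p: "p \<noteq> []" "hd p = x" "last p = y" "distinct p" "successively R p" by blast
  show ?case
  proof (cases "z \<in> set p")
    case True
    then obtain q r where q: "p = (q @ [z]) @ r" by (auto simp: in_set_conv_decomp)
    then have "hd (q @ [z]) = x" using p by (cases q) auto
    then show ?thesis using p(4,5) q
      by (intro exI[of _ "q @ [z]"]) (auto simp: successively_append_iff)
  next
    case False
    then show ?thesis using p step(2)
      by (intro exI[of _ "p @ [z]"]) (auto simp: successively_append_iff)
  qed
qed

locale tree =
  fixes V :: "'a set" and E :: "'a \<Rightarrow> 'a \<Rightarrow> bool"
  assumes is_tree: "is_tree V E"
begin

lemma finite_V: "finite V"
  and edge_in: "E u v \<Longrightarrow> u \<in> V" "E u v \<Longrightarrow> v \<in> V"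
  and edge_sym: "E u v \<Longrightarrow> E v u"
  and no_loop: "\<not> E u u"
  and V_nonempty: "V \<noteq> {}"
  and connected: "u \<in> V \<Longrightarrow> v \<in> V \<Longrightarrow> E\<^sup>*\<^sup>* u v"
  and acyclic: "acyclic_graph V E"
  using is_tree unfolding is_tree_def simple_graph_def connected_graph_def by blast+

lemma del_edge_sym: "del_edge E x y a b \<Longrightarrow> del_edge E x y b a"
  unfolding del_edge_def using edge_sym by (auto simp: doubleton_eq_iff)

lemma del_edge_rtranclp_sym: "(del_edge E x y)\<^sup>*\<^sup>* a b \<Longrightarrow> (del_edge E x y)\<^sup>*\<^sup>* b a"
  by (induction rule: rtranclp_induct)
    (simp, meson converse_rtranclp_into_rtranclp del_edge_sym)

text \<open>A detour from \<open>x\<close> to \<open>y\<close> has at least three vertices, since it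
  is neither trivial nor the edge itself, and the edge closes it to a cycle. All later uses of
  acyclicity go through this lemma.\<close>

lemma bridge:
  assumes "E x y"
  shows "\<not> (del_edge E x y)\<^sup>*\<^sup>* x y"
proof
  assume "(del_edge E x y)\<^sup>*\<^sup>* x y"
  then obtain p where p: "p \<noteq> []" "hd p = x" "last p = y" "distinct p"
    "successively (del_edge E x y) p"
    using rtranclp_distinct_path by metis
  have step: "del_edge E x y (p ! i) (p ! Suc i)" if "Suc i < length p" for i
    using p(5) that by (simp add: successively_conv_nth)
  have "length p \<noteq> 1"
    using p(1-3) assms no_loop by (auto simp: length_Suc_conv)
  moreover have "length p \<noteq> 2"
    using p step[of 0] by (auto simp: length_Suc_conv numeral_2_eq_2 del_edge_def)
  ultimately have len: "3 \<le> length p"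
    using p(1) by (cases "length p") auto
  have "set p \<subseteq> V"
  proof
    fix z assume "z \<in> set p"
    then obtain i where i: "i < length p" "p ! i = z" by (auto simp: in_set_conv_nth)
    show "z \<in> V"
    proof (cases "Suc i < length p")
      case True
      then show ?thesis using step[of i] i edge_in by (auto simp: del_edge_def)
    next
      case False
      then have "z = last p" using i p(1) by (metis Suc_lessI diff_Suc_1 last_conv_nth)
      then show ?thesis using p(3) assms edge_in by auto
    qed
  qed
  moreover have "E (p ! i) (p ! Suc i)" if "Suc i < length p" for i
    using step[OF that] by (simp add: del_edge_def)
  ultimately have "is_cycle V E p"
    unfolding is_cycle_def using p len assms edge_sym by auto
  then show False using acyclic unfolding acyclic_graph_def by blast
qed

lemma no_triangle: "E x y \<Longrightarrow> E y z \<Longrightarrow> E x z \<Longrightarrow> False"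
proof -
  assume xyz: "E x y" "E y z" "E x z"
  then have "x \<noteq> y" "y \<noteq> z" "x \<noteq> z" using no_loop by auto
  then have "del_edge E x y x z" "del_edge E x y z y"
    using xyz edge_sym by (auto simp: del_edge_def doubleton_eq_iff)
  then have "(del_edge E x y)\<^sup>*\<^sup>* x y"
    by (meson r_into_rtranclp rtranclp_trans)
  then show False using bridge[OF xyz(1)] by auto
qed

lemma no_square:
  assumes "E a b" "E b c" "E c d" "E d a" "a \<noteq> c" "b \<noteq> d"
  shows False
proof -
  have ne: "a \<noteq> b" "b \<noteq> c" "c \<noteq> d" "d \<noteq> a" using assms no_loop by auto
  then have "del_edge E a b a d" "del_edge E a b d c" "del_edge E a b c b"
    using assms edge_sym by (auto simp: del_edge_def doubleton_eq_iff)
  then have "(del_edge E a b)\<^sup>*\<^sup>* a b"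
    by (meson r_into_rtranclp rtranclp_trans)
  then show False using bridge[OF assms(1)] by auto
qed

text \<open>For an edge \<open>c u\<close>, \<open>br c u\<close> is the component of \<open>u\<close> after the removal of \<open>c\<close>.\<close>

definition br :: "'a \<Rightarrow> 'a \<Rightarrow> 'a set" where
  "br c u = {x. (\<lambda>a b. E a b \<and> b \<noteq> c)\<^sup>*\<^sup>* u x}"

lemma br_self [simp]: "u \<in> br c u"
  by (simp add: br_def)

lemma br_step: "x \<in> br c u \<Longrightarrow> E x y \<Longrightarrow> y \<noteq> c \<Longrightarrow> y \<in> br c u"
  unfolding br_def by (auto intro: rtranclp.rtrancl_into_rtrancl)

lemma br_induct [consumes 1, case_names base step]:
  assumes "x \<in> br c u" "P u"
    "\<And>a b. a \<in> br c u \<Longrightarrow> P a \<Longrightarrow> E a b \<Longrightarrow> b \<noteq> c \<Longrightarrow> P b"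
  shows "P x"
proof -
  have "(\<lambda>a b. E a b \<and> b \<noteq> c)\<^sup>*\<^sup>* u x" using assms(1) by (simp add: br_def)
  then show ?thesis
    by (induction rule: rtranclp_induct) (use assms(2,3) in \<open>auto simp: br_def\<close>)
qed

lemma root_notin_br: "E c u \<Longrightarrow> c \<notin> br c u"
proof
  assume "E c u" "c \<in> br c u"
  from this(2,1) show False
    by (cases "c = u") (auto simp: no_loop br_def elim: rtranclp.cases)
qed

lemma br_subset_V: "E c u \<Longrightarrow> br c u \<subseteq> V"
proof
  fix x assume "E c u" "x \<in> br c u"
  from this(2,1) show "x \<in> V"
    by (induction rule: br_induct) (auto dest: edge_in)
qed

lemma finite_br: "E c u \<Longrightarrow> finite (br c u)"
  using br_subset_V finite_V finite_subset by blast

lemma br_del_edge: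
  assumes "E c u" "x \<in> br c u"
  shows "(del_edge E c u)\<^sup>*\<^sup>* u x"
  using assms(2)
proof (induction rule: br_induct)
  case (step a b)
  then have "del_edge E c u a b"
    using root_notin_br[OF assms(1)] by (auto simp: del_edge_def doubleton_eq_iff)
  then show ?case using step by auto
qed simp

text \<open>An edge to \<open>c\<close> from another vertex of the branch would bypass the bridge
  \<open>c u\<close>.\<close>

lemma br_exit:
  assumes "E c u" "x \<in> br c u" "E x y" "y \<notin> br c u"
  shows "x = u" "y = c"
proof -
  show y: "y = c" using br_step assms by blast
  show "x = u"
  proof (rule ccontr)
    assume "x \<noteq> u"
    moreover have "x \<noteq> c" using root_notin_br assms by blast
    ultimately have "del_edge E c u x c"
      using assms y no_loop by (auto simp: del_edge_def doubleton_eq_iff)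
    then have "(del_edge E c u)\<^sup>*\<^sup>* u c"
      using br_del_edge[OF assms(1,2)] by auto
    then show False using bridge[OF assms(1)] del_edge_rtranclp_sym by blast
  qed
qed

lemma br_child_subset:
  assumes "E c u" "E u w" "w \<noteq> c"
  shows "br u w \<subseteq> br c u"
proof
  fix x assume "x \<in> br u w"
  then show "x \<in> br c u"
  proof (induction rule: br_induct)
    case base
    then show ?case using br_step[of u c u w] assms by auto
  next
    case (step a b)
    have "a \<noteq> u" using step root_notin_br[OF assms(2)] by auto
    then show ?case using br_exit(1)[OF assms(1), of a b] step by blast
  qed
qed

lemma br_unfold:
  assumes "E c u"
  shows "br c u = insert u (\<Union>w\<in>{w. E u w \<and> w \<noteq> c}. br u w)"
proof
  show "br c u \<subseteq> insert u (\<Union>w\<in>{w. E u w \<and> w \<noteq> c}. br u w)"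
  proof
    fix x assume "x \<in> br c u"
    then show "x \<in> insert u (\<Union>w\<in>{w. E u w \<and> w \<noteq> c}. br u w)"
    proof (induction rule: br_induct)
      case (step a b)
      show ?case
      proof (cases "a = u \<or> b = u")
        case True
        then show ?thesis using step by auto
      next
        case False
        then show ?thesis using step br_step by blast
      qed
    qed simp
  qed
  show "insert u (\<Union>w\<in>{w. E u w \<and> w \<noteq> c}. br u w) \<subseteq> br c u"
    using br_child_subset[OF assms] by auto
qed

lemma br_disjoint:
  assumes "E u w" "E u w'" "w \<noteq> w'"
  shows "br u w \<inter> br u w' = {}"
proof (rule ccontr)
  assume "br u w \<inter> br u w' \<noteq> {}"
  then obtain x where x: "x \<in> br u w" "x \<in> br u w'" by auto
  have "(del_edge E u w)\<^sup>*\<^sup>* w' x" using x(2)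
  proof (induction rule: br_induct)
    case (step a b)
    then have "del_edge E u w a b"
      using root_notin_br[OF assms(2)] by (auto simp: del_edge_def doubleton_eq_iff)
    then show ?case using step by auto
  qed simp
  then have "(del_edge E u w)\<^sup>*\<^sup>* w' w"
    using br_del_edge[OF assms(1) x(1)] del_edge_rtranclp_sym rtranclp_trans by metis
  moreover have "del_edge E u w u w'"
    using assms no_loop by (auto simp: del_edge_def doubleton_eq_iff)
  ultimately show False
    using bridge[OF assms(1)] by (meson converse_rtranclp_into_rtranclp)
qed

text \<open>The size of a branch is the measure for the recursive list constructions.\<close>

lemma br_psubset:
  assumes "E c u" "E u w" "w \<noteq> c"
  shows "card (br u w) < card (br c u)"
proof (rule psubset_card_mono)
  show "br u w \<subset> br c u"
    using br_child_subset[OF assms] root_notin_br[OF assms(2)] br_self by blast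
qed (rule finite_br[OF assms(1)])

lemma br_edge_split:
  assumes "E u v"
  shows "br u v \<inter> br v u = {}" "br u v \<union> br v u = V"
proof -
  show "br u v \<inter> br v u = {}"
  proof (rule ccontr)
    assume "br u v \<inter> br v u \<noteq> {}"
    then obtain x where x: "x \<in> br u v" "x \<in> br v u" by auto
    have "(del_edge E u v)\<^sup>*\<^sup>* v x" "(del_edge E v u)\<^sup>*\<^sup>* u x"
      using br_del_edge assms edge_sym x by blast+
    moreover have "del_edge E v u = del_edge E u v"
      by (auto simp: del_edge_def fun_eq_iff insert_commute)
    ultimately have "(del_edge E u v)\<^sup>*\<^sup>* u v"
      using del_edge_rtranclp_sym rtranclp_trans by metis
    then show False using bridge[OF assms] by auto
  qed
  have "x \<in> br u v \<union> br v u" if "E\<^sup>*\<^sup>* u x" for x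
    using that
  proof (induction rule: rtranclp_induct)
    case (step a b)
    then show ?case using br_step[of a u v b] br_step[of a v u b] br_self by blast
  qed simp
  then have "V \<subseteq> br u v \<union> br v u" using connected edge_in(1)[OF assms] by blast
  then show "br u v \<union> br v u = V"
    using br_subset_V assms edge_sym by blast
qed

section \<open>Distance from a root\<close>

definition depth :: "'a \<Rightarrow> 'a \<Rightarrow> nat" where
  "depth c x = (LEAST n. (E ^^ n) c x)"

lemma depth_reach: "c \<in> V \<Longrightarrow> x \<in> V \<Longrightarrow> (E ^^ depth c x) c x"
  unfolding depth_def using connected rtranclp_imp_relpowp by (metis LeastI)

lemma depth_eq_0_iff: "c \<in> V \<Longrightarrow> x \<in> V \<Longrightarrow> depth c x = 0 \<longleftrightarrow> x = c"
  using depth_reach[of c x] by (auto simp: depth_def intro: Least_eq_0)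

lemma ex_depth_less:
  assumes "c \<in> V" "x \<in> V" "x \<noteq> c"
  shows "\<exists>y. E x y \<and> depth c y < depth c x"
proof -
  obtain m where m: "depth c x = Suc m"
    using depth_eq_0_iff assms by (metis not0_implies_Suc)
  then have "(E ^^ Suc m) c x" using depth_reach assms by metis
  then obtain y where "(E ^^ m) c y" "E y x" by auto
  moreover from this have "depth c y \<le> m" unfolding depth_def by (blast intro: Least_le)
  ultimately show ?thesis using m edge_sym by (intro exI[of _ y]) auto
qed

text \<open>Descending in depth, \<open>y\<close> and \<open>z\<close> both reach \<open>c\<close>
  without meeting \<open>x\<close>; if they differed, the walk from \<open>x\<close> over
  \<open>z\<close> to \<open>y\<close> would bypass the bridge \<open>x y\<close>. Allowing equal
  depth here is what makes \<open>depth_neq\<close> possible.\<close>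

lemma depth_le_unique:
  assumes "c \<in> V" "E x y" "E x z" "depth c y \<le> depth c x" "depth c z \<le> depth c x"
  shows "y = z"
proof (rule ccontr)
  assume yz: "y \<noteq> z"
  have to_root: "(del_edge E x y)\<^sup>*\<^sup>* a c" if "a \<in> V" "a \<noteq> x" "depth c a \<le> depth c x" for a
    using that
  proof (induction "depth c a" arbitrary: a rule: less_induct)
    case less
    show ?case
    proof (cases "a = c")
      case False
      then obtain b where b: "E a b" "depth c b < depth c a"
        using ex_depth_less less.prems assms(1) by blast
      then have "b \<noteq> x" "b \<in> V" using less.prems edge_in by auto
      then have "del_edge E x y a b" "(del_edge E x y)\<^sup>*\<^sup>* b c"
        using b less by (auto simp: del_edge_def doubleton_eq_iff)
      then show ?thesis by auto
    qed simp
  qed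
  have "y \<noteq> x" "z \<noteq> x" "y \<in> V" "z \<in> V" using assms no_loop edge_in by auto
  then have "(del_edge E x y)\<^sup>*\<^sup>* z y"
    using to_root assms del_edge_rtranclp_sym rtranclp_trans by metis
  moreover have "del_edge E x y x z"
    using assms yz \<open>z \<noteq> x\<close> by (auto simp: del_edge_def doubleton_eq_iff)
  ultimately show False
    using bridge[OF assms(2)] by (meson converse_rtranclp_into_rtranclp)
qed

text \<open>At equal depth, \<open>y\<close> would compete with the strictly closer neighbour of
  \<open>x\<close>.\<close>

lemma depth_neq:
  assumes "c \<in> V" "E x y"
  shows "depth c x \<noteq> depth c y"
proof
  assume eq: "depth c x = depth c y"
  have V: "x \<in> V" "y \<in> V" using edge_in assms by auto
  have "x \<noteq> c" using eq depth_eq_0_iff assms(1) V no_loop assms(2) by metis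
  then obtain z where "E x z" "depth c z < depth c x" using ex_depth_less V assms(1) by blast
  then show False using depth_le_unique[OF assms(1) assms(2), of z] eq by auto
qed

end

section \<open>Legs and induced spiders\<close>

text \<open>\<open>leg E c u i m\<close>: some non-backtracking walk of length \<open>i\<close> starts with the edge \<open>c u\<close>, and
  its last vertex has \<open>m\<close> neighbours other than its predecessor.\<close>

inductive leg :: "('a \<Rightarrow> 'a \<Rightarrow> bool) \<Rightarrow> 'a \<Rightarrow> 'a \<Rightarrow> nat \<Rightarrow> nat \<Rightarrow> bool" for E where
  tip: "E c u \<Longrightarrow> finite S \<Longrightarrow> card S = m \<Longrightarrow> c \<notin> S \<Longrightarrow> \<forall>x\<in>S. E u x \<Longrightarrow> leg E c u (Suc 0) m"
| step: "E c u \<Longrightarrow> E u v \<Longrightarrow> v \<noteq> c \<Longrightarrow> leg E u v i m \<Longrightarrow> leg E c u (Suc i) m"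

lemma leg_edge: "leg E c u i m \<Longrightarrow> E c u"
  by (induction rule: leg.induct) auto

lemma leg_pos: "leg E c u i m \<Longrightarrow> 0 < i"
  by (induction rule: leg.induct) auto

lemma leg_mono: "leg E c u i m \<Longrightarrow> m' \<le> m \<Longrightarrow> leg E c u i m'"
proof (induction rule: leg.induct)
  case (tip c u S m)
  then obtain S' where "S' \<subseteq> S" "card S' = m'" using obtain_subset_with_card_n by metis
  then show ?case using tip finite_subset by (intro leg.tip[of E c u S']) auto
qed (auto intro: leg.step)

text \<open>Indexing the walk by its distance from \<open>c\<close> matches the vertices
  \<open>(Suc b, d, 0)\<close> of a spider; \<open>walk_leg\<close> is the way back.\<close>

lemma leg_walk:
  assumes "leg E c u i m"
  shows "\<exists>f S. f 0 = c \<and> f 1 = u \<and> (\<forall>d<i. E (f d) (f (Suc d))) \<and>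
    (\<forall>d. Suc d < i \<longrightarrow> f (Suc (Suc d)) \<noteq> f d) \<and>
    finite S \<and> card S = m \<and> f (i - 1) \<notin> S \<and> (\<forall>x\<in>S. E (f i) x)"
  using assms
proof (induction rule: leg.induct)
  case (tip c u S m)
  then show ?case
    by (intro exI[of _ "\<lambda>d. if d = 0 then c else u"] exI[of _ S]) auto
next
  case (step c u v i m)
  then obtain f S where f: "f 0 = u" "f 1 = v" "\<forall>d<i. E (f d) (f (Suc d))"
    "\<forall>d. Suc d < i \<longrightarrow> f (Suc (Suc d)) \<noteq> f d"
    "finite S" "card S = m" "f (i - 1) \<notin> S" "\<forall>x\<in>S. E (f i) x" by blast
  define g where "g = (\<lambda>d. if d = 0 then c else f (d - 1))"
  have "0 < i" using step leg_pos by metis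
  then have "g 0 = c" "g 1 = u" "\<forall>d<Suc i. E (g d) (g (Suc d))"
    "\<forall>d. Suc d < Suc i \<longrightarrow> g (Suc (Suc d)) \<noteq> g d" "g (Suc i - 1) \<notin> S" "\<forall>x\<in>S. E (g (Suc i)) x"
    using step f by (auto simp: g_def gr0_conv_Suc less_Suc_eq_0_disj)
  then show ?case using f by blast
qed

lemma walk_leg:
  assumes "d < i" "\<And>d. d < i \<Longrightarrow> E (f d) (f (Suc d))"
    "\<And>d. Suc d < i \<Longrightarrow> f (Suc (Suc d)) \<noteq> f d"
    "finite S" "card S = m" "f (i - 1) \<notin> S" "\<forall>x\<in>S. E (f i) x"
  shows "leg E (f d) (f (Suc d)) (i - d) m"
  using assms(1)
proof (induction "i - d" arbitrary: d)
  case (Suc k)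
  show ?case
  proof (cases "Suc d = i")
    case True
    then show ?thesis using assms leg.tip[of E "f d" "f (Suc d)" S m] by auto
  next
    case False
    then have "Suc d < i" using Suc.prems by simp
    then have "leg E (f (Suc d)) (f (Suc (Suc d))) (i - Suc d) m" using Suc by auto
    then have "leg E (f d) (f (Suc d)) (Suc (i - Suc d)) m"
      using assms(2,3) \<open>Suc d < i\<close> by (intro leg.step) auto
    then show ?thesis using \<open>Suc d < i\<close> by (simp add: Suc_diff_Suc)
  qed
qed simp

text \<open>Views the spider as a tree rooted at \<open>(0,0,0)\<close>, so that its three kinds of
  edges become one relation. The root is its own parent.\<close>

definition spider_parent :: "nat \<times> nat \<times> nat \<Rightarrow> nat \<times> nat \<times> nat" where
  "spider_parent v = (case v of (b, d, l) \<Rightarrow>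
     if 0 < l then (b, d, 0) else if d \<le> 1 then (0, 0, 0) else (b, d - 1, 0))"

lemma spider_E0_parent:
  assumes "\<And>b. b < length bs \<Longrightarrow> 1 \<le> fst (bs ! b)" "v \<in> spider_V bs"
  shows "spider_E0 bs u v \<longleftrightarrow> v \<noteq> (0,0,0) \<and> u = spider_parent v"
proof
  assume "spider_E0 bs u v"
  then show "v \<noteq> (0,0,0) \<and> u = spider_parent v"
    by (auto simp: spider_E0_def spider_parent_def)
next
  assume R: "v \<noteq> (0,0,0) \<and> u = spider_parent v"
  then consider b d where "v = (Suc b, d, 0)" "b < length bs" "1 \<le> d" "d \<le> fst (bs ! b)"
    | b l where "v = (Suc b, fst (bs ! b), l)" "b < length bs" "1 \<le> l" "l \<le> snd (bs ! b)"
    using assms(2) unfolding spider_V_def by auto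
  then show "spider_E0 bs u v"
  proof cases
    case 1
    show ?thesis
    proof (cases "d = 1")
      case True
      then show ?thesis using R 1 unfolding spider_E0_def by (auto simp: spider_parent_def)
    next
      case False
      have "\<exists>b d. b < length bs \<and> 1 \<le> d \<and> d < fst (bs ! b) \<and> u = (Suc b, d, 0) \<and> v = (Suc b, Suc d, 0)"
        using R 1 False by (intro exI[of _ b] exI[of _ "d - 1"]) (auto simp: spider_parent_def)
      then show ?thesis unfolding spider_E0_def by blast
    qed
  next
    case 2
    then show ?thesis using R unfolding spider_E0_def by (auto simp: spider_parent_def)
  qed
qed

lemma spider_V_cases:
  assumes "v \<in> spider_V bs"
  obtains (root) "v = (0,0,0)"
    | (path) b d where "v = (Suc b, Suc d, 0)" "b < length bs" "d < fst (bs ! b)"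
    | (leaf) b l where "v = (Suc b, fst (bs ! b), Suc l)" "b < length bs" "l < snd (bs ! b)"
  using assms unfolding spider_V_def by (auto simp: Suc_le_eq gr0_conv_Suc)

lemma spider_V_intros:
  "(0,0,0) \<in> spider_V bs"
  "b < length bs \<Longrightarrow> 1 \<le> d \<Longrightarrow> d \<le> fst (bs ! b) \<Longrightarrow> (Suc b, d, 0) \<in> spider_V bs"
  "b < length bs \<Longrightarrow> 1 \<le> l \<Longrightarrow> l \<le> snd (bs ! b) \<Longrightarrow> (Suc b, fst (bs ! b), l) \<in> spider_V bs"
  unfolding spider_V_def by auto

text \<open>Positive lengths matter for the leaves: in a branch of length 0 they would hang off
  \<open>(Suc b, 0, 0)\<close>, which is no vertex.\<close>

lemma spider_parent_in_V:
  assumes "v \<in> spider_V bs" "\<And>b. b < length bs \<Longrightarrow> 1 \<le> fst (bs ! b)"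
  shows "spider_parent v \<in> spider_V bs"
  using assms(1)
proof (cases rule: spider_V_cases)
  case (path b d)
  then show ?thesis by (cases d) (simp_all add: spider_parent_def spider_V_intros)
next
  case (leaf b l)
  then show ?thesis using assms(2) by (simp add: spider_parent_def spider_V_intros)
qed (simp add: spider_parent_def spider_V_intros)

text \<open>Injectivity of the embedding keeps the images of the branches from backtracking and
  their first vertices distinct.\<close>

lemma has_spider_legs:
  assumes "has_spider V E bs" "\<And>b. b < length bs \<Longrightarrow> 1 \<le> fst (bs ! b)"
  shows "\<exists>c us. distinct us \<and> length us = length bs \<and>
    (\<forall>b<length bs. leg E c (us ! b) (fst (bs ! b)) (snd (bs ! b)))"
proof -
  obtain \<phi> where \<phi>: "inj_on \<phi> (spider_V bs) \<and> \<phi> ` spider_V bs \<subseteq> V \<and>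
      (\<forall>u\<in>spider_V bs. \<forall>v\<in>spider_V bs. spider_E bs u v \<longleftrightarrow> E (\<phi> u) (\<phi> v))"
    using assms(1) unfolding has_induced_def by (elim exE)
  then have inj: "inj_on \<phi> (spider_V bs)" by (elim conjE)
  have hom: "E (\<phi> u) (\<phi> v)" if "u \<in> spider_V bs" "v \<in> spider_V bs" "spider_E0 bs u v" for u v
  proof -
    have "spider_E bs u v" using that(3) by (simp add: spider_E_def)
    then show ?thesis using \<phi> that(1,2) by metis
  qed
  define us where "us = map (\<lambda>b. \<phi> (Suc b, 1, 0)) [0..<length bs]"
  have "(Suc b, 1, 0) \<in> spider_V bs" if "b < length bs" for b
    using spider_V_intros(2)[OF that] assms(2)[OF that] by simp
  then have "inj_on (\<lambda>b. \<phi> (Suc b, 1, 0)) {0..<length bs}"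
    by (intro inj_onI) (auto dest!: inj_onD[OF inj])
  then have "distinct us" by (simp add: us_def distinct_map)
  moreover have "leg E (\<phi> (0,0,0)) (us ! b) (fst (bs ! b)) (snd (bs ! b))" if b: "b < length bs" for b
  proof -
    define pt where "pt = (\<lambda>d::nat. if d = 0 then (0,0,0) else (Suc b, d, 0 :: nat))"
    define lf where "lf = (\<lambda>l::nat. (Suc b, fst (bs ! b), l))"
    have pt_V: "pt d \<in> spider_V bs" if "d \<le> fst (bs ! b)" for d
      using spider_V_intros(2)[OF b, of d] spider_V_intros(1) that by (simp add: pt_def)
    have lf_V: "lf l \<in> spider_V bs" if "l \<in> {1..snd (bs ! b)}" for l
      using spider_V_intros(3)[OF b, of l] that by (simp add: lf_def)
    have fst: "1 \<le> fst (bs ! b)" using assms(2) b by simp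
    have "leg E (\<phi> (pt 0)) (\<phi> (pt (Suc 0))) (fst (bs ! b) - 0) (snd (bs ! b))"
    proof (rule walk_leg[where f = "\<lambda>d. \<phi> (pt d)" and S = "\<phi> ` lf ` {1..snd (bs ! b)}"])
      show "E (\<phi> (pt d)) (\<phi> (pt (Suc d)))" if "d < fst (bs ! b)" for d
      proof -
        have "spider_E0 bs (pt d) (pt (Suc d))"
          using b that by (auto simp: pt_def spider_E0_def)
        then show ?thesis using hom[of "pt d" "pt (Suc d)"] pt_V that by simp
      qed
      show "\<phi> (pt (Suc (Suc d))) \<noteq> \<phi> (pt d)" if "Suc d < fst (bs ! b)" for d
        using inj_onD[OF inj, of "pt (Suc (Suc d))" "pt d"] pt_V[of d] pt_V[of "Suc (Suc d)"] that
        by (auto simp: pt_def split: if_splits)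
      show "card (\<phi> ` lf ` {1..snd (bs ! b)}) = snd (bs ! b)"
      proof -
        have "inj_on \<phi> (lf ` {1..snd (bs ! b)})" using inj lf_V by (auto intro: inj_on_subset)
        moreover have "inj_on lf {1..snd (bs ! b)}" by (auto simp: lf_def inj_on_def)
        ultimately show ?thesis by (simp add: card_image)
      qed
      show "\<phi> (pt (fst (bs ! b) - 1)) \<notin> \<phi> ` lf ` {1..snd (bs ! b)}"
      proof
        assume "\<phi> (pt (fst (bs ! b) - 1)) \<in> \<phi> ` lf ` {1..snd (bs ! b)}"
        then obtain l where "l \<in> {1..snd (bs ! b)}" "\<phi> (pt (fst (bs ! b) - 1)) = \<phi> (lf l)" by auto
        then have "pt (fst (bs ! b) - 1) = lf l"
          using inj_onD[OF inj] pt_V lf_V by auto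
        then show False using \<open>l \<in> _\<close> by (auto simp: pt_def lf_def split: if_splits)
      qed
      show "\<forall>x\<in>\<phi> ` lf ` {1..snd (bs ! b)}. E (\<phi> (pt (fst (bs ! b)))) x"
      proof (intro ballI, elim imageE, hypsubst)
        fix l assume l: "l \<in> {1..snd (bs ! b)}"
        then have "spider_E0 bs (pt (fst (bs ! b))) (lf l)"
          using b fst by (auto simp: pt_def lf_def spider_E0_def)
        then show "E (\<phi> (pt (fst (bs ! b)))) (\<phi> (lf l))"
          using hom[of "pt (fst (bs ! b))" "lf l"] pt_V lf_V l by simp
      qed
    qed (use fst in auto)
    then show ?thesis using b by (simp add: us_def pt_def)
  qed
  ultimately show ?thesis by (auto simp: us_def intro!: exI[of _ "\<phi> (0,0,0)"] exI[of _ us])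
qed

context tree
begin

text \<open>A locally injective homomorphism from a rooted tree \<open>W\<close> into \<open>V\<close> never backtracks, so it
  moves away from the image of the root and is an induced embedding.\<close>

lemma has_induced_if_locally_injective:
  fixes par :: "'b \<Rightarrow> 'b" and rank :: "'b \<Rightarrow> nat"
  assumes root: "\<phi> r \<in> V"
    and par: "\<And>v. v \<in> W \<Longrightarrow> v \<noteq> r \<Longrightarrow> par v \<in> W \<and> rank (par v) < rank v"
    and F: "\<And>u v. u \<in> W \<Longrightarrow> v \<in> W \<Longrightarrow> F u v \<longleftrightarrow> (v \<noteq> r \<and> u = par v) \<or> (u \<noteq> r \<and> v = par u)"
    and hom: "\<And>v. v \<in> W \<Longrightarrow> v \<noteq> r \<Longrightarrow> E (\<phi> v) (\<phi> (par v))"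
    and siblings: "\<And>u v. u \<in> W \<Longrightarrow> v \<in> W \<Longrightarrow> u \<noteq> r \<Longrightarrow> v \<noteq> r \<Longrightarrow> par u = par v \<Longrightarrow>
      \<phi> u = \<phi> v \<Longrightarrow> u = v"
    and grandparent: "\<And>v. v \<in> W \<Longrightarrow> v \<noteq> r \<Longrightarrow> par v \<noteq> r \<Longrightarrow> \<phi> (par (par v)) \<noteq> \<phi> v"
  shows "has_induced V E W F"
proof -
  let ?d = "depth (\<phi> r)"
  have inV: "\<phi> v \<in> V" if "v \<in> W" for v
    using hom[OF that] edge_in root by (cases "v = r") auto
  \<comment> \<open>By induction the image of the grandparent is the only neighbour of
    \<open>\<phi> (par v)\<close> that is not deeper; \<open>\<phi> v\<close> differs from it and so
    must be deeper.\<close>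
  have up: "?d (\<phi> (par v)) < ?d (\<phi> v)" if "v \<in> W" "v \<noteq> r" for v
    using that
  proof (induction "rank v" arbitrary: v rule: less_induct)
    case less
    have E: "E (\<phi> (par v)) (\<phi> v)" using hom less.prems edge_sym by blast
    show ?case
    proof (rule ccontr)
      assume "\<not> ?thesis"
      then have le: "?d (\<phi> v) \<le> ?d (\<phi> (par v))" by simp
      show False
      proof (cases "par v = r")
        case True
        then have "?d (\<phi> v) = 0" using le depth_eq_0_iff[OF root root] by simp
        then have "\<phi> v = \<phi> r" using depth_eq_0_iff root inV less.prems by metis
        then show False using E True no_loop by simp
      next
        case False
        have "par v \<in> W" "rank (par v) < rank v" using par less.prems by auto
        then have "?d (\<phi> (par (par v))) < ?d (\<phi> (par v))" "E (\<phi> (par v)) (\<phi> (par (par v)))"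
          using less False hom by auto
        then show False
          using depth_le_unique[OF root E, of "\<phi> (par (par v))"] le grandparent[OF less.prems False]
          by auto
      qed
    qed
  qed
  \<comment> \<open>Equal images have the same unique closer neighbour, so the parents have equal
    images. Induction identifies the parents, and then \<open>siblings\<close> applies.\<close>
  have inj: "u = v" if "u \<in> W" "v \<in> W" "\<phi> u = \<phi> v" for u v
    using that
  proof (induction "rank u" arbitrary: u v rule: less_induct)
    case less
    have "?d (\<phi> r) = 0" using depth_eq_0_iff root by blast
    then have "?d (\<phi> w) = 0 \<longleftrightarrow> w = r" if "w \<in> W" for w using up[OF that] by fastforce
    then have "u = r \<longleftrightarrow> v = r" using less.prems by metis
    show ?case
    proof (cases "u = r")
      case True
      then show ?thesis using \<open>u = r \<longleftrightarrow> v = r\<close> by simp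
    next
      case False
      then have nr: "u \<noteq> r" "v \<noteq> r" using \<open>u = r \<longleftrightarrow> v = r\<close> by auto
      have "\<phi> (par u) = \<phi> (par v)"
        using depth_le_unique[OF root, of "\<phi> u" "\<phi> (par u)" "\<phi> (par v)"]
          hom[OF less.prems(1) nr(1)] hom[OF less.prems(2) nr(2)]
          up[OF less.prems(1) nr(1)] up[OF less.prems(2) nr(2)] less.prems(3) by auto
      then have "par u = par v" using less par nr by auto
      then show ?thesis using siblings less.prems nr by blast
    qed
  qed
  have adj: "v \<noteq> r \<and> u = par v" if "u \<in> W" "v \<in> W" "E (\<phi> u) (\<phi> v)" "?d (\<phi> u) < ?d (\<phi> v)" for u v
  proof -
    have "?d (\<phi> r) = 0" using depth_eq_0_iff root by blast
    then have "v \<noteq> r" using that(4) by auto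
    moreover have "\<phi> u = \<phi> (par v)"
      using depth_le_unique[OF root, of "\<phi> v" "\<phi> u" "\<phi> (par v)"] hom[OF that(2) \<open>v \<noteq> r\<close>]
        up[OF that(2) \<open>v \<noteq> r\<close>] that(3,4) edge_sym by auto
    ultimately show ?thesis using inj par that by blast
  qed
  have "F u v \<longleftrightarrow> E (\<phi> u) (\<phi> v)" if "u \<in> W" "v \<in> W" for u v
    using F[OF that] hom[of u] hom[of v] adj[of u v] adj[of v u] that edge_sym
      depth_neq[OF root, of "\<phi> u" "\<phi> v"] by (metis linorder_neq_iff)
  then show ?thesis
    unfolding has_induced_def using inV inj by (intro exI[of _ \<phi>]) (auto simp: inj_on_def)
qed

text \<open>Only local injectivity is checked: at the centre it is distinctness of
  \<open>us\<close>, along a path it is the absence of backtracking, and at the end of a leg it is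
  the choice of \<open>m\<close> distinct further neighbours.\<close>

lemma legs_has_spider:
  assumes c: "c \<in> V" and us: "distinct us" "length us = length bs"
    and legs: "\<And>b. b < length bs \<Longrightarrow> leg E c (us ! b) (fst (bs ! b)) (snd (bs ! b))"
  shows "has_spider V E bs"
proof -
  have len: "1 \<le> fst (bs ! b)" if "b < length bs" for b
    using leg_pos[OF legs[OF that]] by simp
  define walk where "walk b f S \<longleftrightarrow> f 0 = c \<and> f 1 = us ! b \<and>
    (\<forall>d<fst (bs ! b). E (f d) (f (Suc d))) \<and>
    (\<forall>d. Suc d < fst (bs ! b) \<longrightarrow> f (Suc (Suc d)) \<noteq> f d) \<and>
    finite S \<and> card S = snd (bs ! b) \<and> f (fst (bs ! b) - 1) \<notin> S \<and> (\<forall>x\<in>S. E (f (fst (bs ! b))) x)"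
    for b and f :: "nat \<Rightarrow> 'a" and S
  have "\<forall>b. \<exists>f S. b < length bs \<longrightarrow> walk b f S"
    using leg_walk[OF legs] unfolding walk_def by blast
  then obtain f S where walk: "\<And>b. b < length bs \<Longrightarrow> walk b (f b) (S b)"
    by metis
  have f: "\<And>b. b < length bs \<Longrightarrow> f b 0 = c" "\<And>b. b < length bs \<Longrightarrow> f b 1 = us ! b"
    "\<And>b d. b < length bs \<Longrightarrow> d < fst (bs ! b) \<Longrightarrow> E (f b d) (f b (Suc d))"
    "\<And>b d. b < length bs \<Longrightarrow> Suc d < fst (bs ! b) \<Longrightarrow> f b (Suc (Suc d)) \<noteq> f b d"
    and S: "\<And>b. b < length bs \<Longrightarrow> finite (S b) \<and> card (S b) = snd (bs ! b) \<and>
      f b (fst (bs ! b) - 1) \<notin> S b \<and> (\<forall>x\<in>S b. E (f b (fst (bs ! b))) x)"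
    using walk unfolding walk_def by simp_all
  have "\<exists>g. bij_betw g {1..snd (bs ! b)} (S b)" if "b < length bs" for b
    using S[OF that] by (intro finite_same_card_bij) auto
  then obtain g where g: "\<And>b. b < length bs \<Longrightarrow> bij_betw (g b) {1..snd (bs ! b)} (S b)" by metis
  have gS: "g b l \<in> S b" if "b < length bs" "1 \<le> l" "l \<le> snd (bs ! b)" for b l
    using g[OF that(1)] that by (auto simp: bij_betw_def)
  define \<phi> where "\<phi> = (\<lambda>(b, d, l). if b = 0 then c else if l = 0 then f (b - 1) d else g (b - 1) l)"
  show ?thesis
  proof (rule has_induced_if_locally_injective[where \<phi> = \<phi> and r = "(0,0,0)"
        and par = spider_parent and rank = "\<lambda>(b, d, l). d + l"])
    fix v assume v: "v \<in> spider_V bs" "v \<noteq> (0,0,0)"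
    have "(case spider_parent v of (b, d, l) \<Rightarrow> d + l) < (case v of (b, d, l) \<Rightarrow> d + l)"
      using v by (cases rule: spider_V_cases) (auto simp: spider_parent_def)
    then show "spider_parent v \<in> spider_V bs \<and>
      (case spider_parent v of (b, d, l) \<Rightarrow> d + l) < (case v of (b, d, l) \<Rightarrow> d + l)"
      using spider_parent_in_V[of v bs] v len by simp
    show "E (\<phi> v) (\<phi> (spider_parent v))"
      using v
    proof (cases rule: spider_V_cases)
      case (path b d)
      then show ?thesis
        using f(1)[of b] f(3)[of b d] edge_sym by (auto simp: \<phi>_def spider_parent_def)
    next
      case (leaf b l)
      then show ?thesis
        using S[of b] gS[of b "Suc l"] len[of b] edge_sym by (auto simp: \<phi>_def spider_parent_def)
    qed simp
    assume nr: "spider_parent v \<noteq> (0,0,0)"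
    show "\<phi> (spider_parent (spider_parent v)) \<noteq> \<phi> v"
      using v
    proof (cases rule: spider_V_cases)
      case (path b d)
      then obtain d' where "d = Suc d'" using nr by (cases d) (auto simp: spider_parent_def)
      then show ?thesis
        using path f(1)[of b] f(4)[of b d'] by (cases d') (auto simp: \<phi>_def spider_parent_def)
    next
      case (leaf b l)
      then have "\<phi> (spider_parent (spider_parent v)) = f b (fst (bs ! b) - 1)"
        using len[of b] f(1)[of b] by (auto simp: \<phi>_def spider_parent_def)
      then show ?thesis using leaf S[of b] gS[of b "Suc l"] by (auto simp: \<phi>_def)
    qed simp
  next
    fix u v assume uv: "u \<in> spider_V bs" "v \<in> spider_V bs"
    show "spider_E bs u v \<longleftrightarrow> v \<noteq> (0,0,0) \<and> u = spider_parent v \<or> u \<noteq> (0,0,0) \<and> v = spider_parent u"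
      unfolding spider_E_def using spider_E0_parent len uv by blast
    assume nr: "u \<noteq> (0,0,0)" "v \<noteq> (0,0,0)" and eq: "spider_parent u = spider_parent v" "\<phi> u = \<phi> v"
    \<comment> \<open>A path vertex and a leaf are never siblings: the parent of a leaf is the last
      vertex of its path.\<close>
    consider (path) b d b' d' where "u = (Suc b, Suc d, 0)" "b < length bs" "d < fst (bs ! b)"
        "v = (Suc b', Suc d', 0)" "b' < length bs" "d' < fst (bs ! b')"
      | (leaf) b l b' l' where "u = (Suc b, fst (bs ! b), Suc l)" "b < length bs" "l < snd (bs ! b)"
        "v = (Suc b', fst (bs ! b'), Suc l')" "b' < length bs" "l' < snd (bs ! b')"
      | (path_leaf) b d b' l' where "u = (Suc b, Suc d, 0)" "d < fst (bs ! b)"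
        "v = (Suc b', fst (bs ! b'), Suc l')"
      | (leaf_path) b l b' d' where "u = (Suc b, fst (bs ! b), Suc l)"
        "v = (Suc b', Suc d', 0)" "d' < fst (bs ! b')"
      using spider_V_cases[OF uv(1)] spider_V_cases[OF uv(2)] nr by metis
    then show "u = v"
    proof cases
      case path
      show ?thesis
      proof (cases "d = 0")
        case True
        then have "d' = 0" using path eq by (auto simp: spider_parent_def split: if_splits)
        then have "us ! b = us ! b'" using eq(2) path True f(2) by (simp add: \<phi>_def)
        then show ?thesis using path us True \<open>d' = 0\<close> by (simp add: nth_eq_iff_index_eq)
      next
        case False
        then show ?thesis using path eq by (auto simp: spider_parent_def split: if_splits)
      qed
    next
      case leaf
      then have "b = b'" using eq(1) by (simp add: spider_parent_def)
      then have "g b (Suc l) = g b (Suc l')" using leaf eq(2) by (simp add: \<phi>_def)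
      then show ?thesis
        using leaf \<open>b = b'\<close> inj_onD[OF bij_betw_imp_inj_on[OF g], of b "Suc l" "Suc l'"] by simp
    next
      case path_leaf
      then show ?thesis using eq(1) by (auto simp: spider_parent_def split: if_splits)
    next
      case leaf_path
      then show ?thesis using eq(1) by (auto simp: spider_parent_def split: if_splits)
    qed
  qed (use c in \<open>auto simp: \<phi>_def\<close>)
qed

end


section \<open>Strongly consistent orderings with two classes\<close>

context tree
begin

text \<open>Three heavy branches at a vertex form a spider of one of the families \<open>T1\<close> to \<open>T4\<close>; three
  medium branches and one more edge contain one of the family \<open>T5\<close> or \<open>T2\<close>.\<close>

definition med :: "'a \<Rightarrow> 'a \<Rightarrow> bool" where
  "med c u \<longleftrightarrow> (\<exists>i. leg E c u i 2)"

definition heavy :: "'a \<Rightarrow> 'a \<Rightarrow> bool" where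
  "heavy c u \<longleftrightarrow> leg E c u 1 3 \<or> (\<exists>i\<ge>2. leg E c u i 2)"

lemma heavy_imp_med: "heavy c u \<Longrightarrow> med c u"
  unfolding heavy_def med_def using leg_mono[of E c u _ 3 2] by fastforce

lemma med_edge: "med c u \<Longrightarrow> E c u"
  unfolding med_def using leg_edge by metis

lemma med_tip: "E c u \<Longrightarrow> E u x \<Longrightarrow> E u y \<Longrightarrow> x \<noteq> y \<Longrightarrow> x \<noteq> c \<Longrightarrow> y \<noteq> c \<Longrightarrow> med c u"
  unfolding med_def using leg.tip[of E c u "{x, y}" 2] by auto

text \<open>Prepending an edge makes the leg at least 2 long. Read backwards: below a branch that is
  not heavy no branch is medium.\<close>

lemma med_step: "E c u \<Longrightarrow> E u v \<Longrightarrow> v \<noteq> c \<Longrightarrow> med u v \<Longrightarrow> heavy c u"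
  unfolding med_def heavy_def using leg_pos[of E u v] leg.step[of E c u v]
  by (metis Suc_leI Suc_le_mono numeral_2_eq_2)

lemma heavy_tip:
  "E c u \<Longrightarrow> E u x \<Longrightarrow> E u y \<Longrightarrow> E u z \<Longrightarrow> distinct [x, y, z, c] \<Longrightarrow> heavy c u"
  unfolding heavy_def using leg.tip[of E c u "{x, y, z}" 3] by auto

lemma leg_tip_cases:
  assumes "leg E c u (Suc 0) m"
  obtains S where "finite S" "card S = m" "c \<notin> S" "\<forall>x\<in>S. E u x"
  using assms by (cases rule: leg.cases) (auto dest: leg_pos)

lemma leg_2_cases:
  assumes "leg E c u i 2"
  shows "i = Suc 0 \<and> (\<exists>x y. E u x \<and> E u y \<and> x \<noteq> y \<and> x \<noteq> c \<and> y \<noteq> c) \<or>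
    2 \<le> i \<and> (\<exists>v. E u v \<and> v \<noteq> c \<and> med u v)"
  using assms
proof (cases rule: leg.cases)
  case (tip S)
  then show ?thesis by (auto simp: card_2_iff)
next
  case (step v j)
  then show ?thesis using leg_pos[of E u v j 2] unfolding med_def by (auto simp: Suc_le_eq)
qed

lemma med_cases:
  assumes "med c u"
  shows "(\<exists>x y. E u x \<and> E u y \<and> x \<noteq> y \<and> x \<noteq> c \<and> y \<noteq> c) \<or> (\<exists>v. E u v \<and> v \<noteq> c \<and> med u v)"
proof -
  obtain i where "leg E c u i 2" using assms unfolding med_def by blast
  then show ?thesis using leg_2_cases by metis
qed

lemma heavy_cases:
  assumes "heavy c u"
  shows "(\<exists>x y z. E u x \<and> E u y \<and> E u z \<and> distinct [x, y, z, c]) \<or> (\<exists>v. E u v \<and> v \<noteq> c \<and> med u v)"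
  using assms unfolding heavy_def
proof (elim disjE exE conjE)
  assume "leg E c u 1 3"
  then obtain S where "card S = 3" "c \<notin> S" "\<forall>x\<in>S. E u x"
    by (metis One_nat_def leg_tip_cases)
  then show ?thesis by (auto simp: card_3_iff)
next
  fix i assume "2 \<le> i" "leg E c u i 2"
  then show ?thesis using leg_2_cases[of c u i] by simp
qed

lemma med_induct [consumes 1, case_names tip step]:
  assumes "med c u"
    and "\<And>c u x y. E c u \<Longrightarrow> E u x \<Longrightarrow> E u y \<Longrightarrow> x \<noteq> y \<Longrightarrow> x \<noteq> c \<Longrightarrow> y \<noteq> c \<Longrightarrow> P c u"
    and "\<And>c u v. E c u \<Longrightarrow> E u v \<Longrightarrow> v \<noteq> c \<Longrightarrow> P u v \<Longrightarrow> P c u"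
  shows "P c u"
proof -
  obtain i where "leg E c u i 2" using assms(1) unfolding med_def by blast
  then show ?thesis
  proof (induction c u i "2::nat" rule: leg.induct)
    case (tip c u S)
    then obtain x y where "S = {x, y}" "x \<noteq> y" by (metis card_2_iff)
    then show ?case using tip assms(2)[of c u x y] by auto
  qed (use assms(3) in blast)
qed

end

text \<open>Positions are integers so that negation reverses the ordering; a Boolean suffices for
  two classes. Membership is demanded of \<open>s\<close> only, because \<open>E r t\<close> already
  places \<open>r\<close> and \<open>t\<close> in \<open>V\<close>.\<close>

locale strip = tree +
  fixes ord :: "'a \<Rightarrow> int" and A :: "'a \<Rightarrow> bool"
  assumes ord_inj: "inj_on ord V"
    and sc_left: "s \<in> V \<Longrightarrow> ord r < ord s \<Longrightarrow> ord s < ord t \<Longrightarrow> E r t \<Longrightarrow> A r = A s \<Longrightarrow> E s t"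
    and sc_right: "s \<in> V \<Longrightarrow> ord r < ord s \<Longrightarrow> ord s < ord t \<Longrightarrow> E r t \<Longrightarrow> A s = A t \<Longrightarrow> E r s"
begin

text \<open>Every statement about the right side thereby yields one about the left side.\<close>

lemma mirror: "strip V E (\<lambda>x. - ord x) A"
proof
  show "inj_on (\<lambda>x. - ord x) V" using ord_inj by (auto simp: inj_on_def)
  fix r s t
  assume *: "s \<in> V" "- ord r < - ord s" "- ord s < - ord t" "E r t"
  show "E s t" if "A r = A s" using sc_right[of s t r] * that edge_sym[of r t] edge_sym[of t s] by simp
  show "E r s" if "A s = A t" using sc_left[of s t r] * that edge_sym[of r t] edge_sym[of s r] by simp
qed

lemma ord_neq: "x \<in> V \<Longrightarrow> y \<in> V \<Longrightarrow> x \<noteq> y \<Longrightarrow> ord x \<noteq> ord y"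
  using ord_inj by (auto simp: inj_on_def)

text \<open>With all three in one class, both conclusions of strong consistency apply and close a
  triangle.\<close>

lemma same_adj:
  "E r t \<Longrightarrow> A r = A t \<Longrightarrow> s \<in> V \<Longrightarrow> A s = A t \<Longrightarrow> ord r < ord s \<Longrightarrow> ord s < ord t \<Longrightarrow> False"
  using sc_left[of s r t] sc_right[of s r t] no_triangle[of r s t] by simp

lemma same_right_unique:
  assumes "E c x" "E c y" "A x = A c" "A y = A c" "ord c < ord x" "ord c < ord y"
  shows "x = y"
proof (rule ccontr)
  assume "x \<noteq> y"
  moreover have V: "x \<in> V" "y \<in> V" using assms edge_in by auto
  ultimately consider "ord x < ord y" | "ord y < ord x" using ord_neq[of x y] by linarith
  then show False
    using same_adj[of c x y] same_adj[of c y x] assms V by cases auto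
qed

text \<open>If \<open>s\<close> lies right of \<open>x\<close>, it lies under the edge
  \<open>x z\<close>, otherwise under \<open>y x\<close>; in both cases it shares the class of the
  far end.\<close>

lemma consec:
  assumes "E x y" "E x z" "A y \<noteq> A x" "A z \<noteq> A x" "ord y < ord s" "ord s < ord z" "s \<in> V" "A s = A y"
  shows "E x s"
proof (cases "ord x < ord s")
  case True
  then show ?thesis using sc_right[of s x z] assms by auto
next
  case False
  then have "ord s < ord x" using ord_neq[of x s] assms edge_in by fastforce
  then show ?thesis using sc_left[of s y x] assms edge_sym by auto
qed

text \<open>Strong consistency adds the two missing edges \<open>x s\<close> and \<open>x' y\<close>
  to a crossing pair, and the four vertices then form a square.\<close>

lemma noncross:
  assumes "A x = A x'" "A s = A y" "A x \<noteq> A s" "ord x < ord x'" "ord s < ord y" "E x y" "E x' s"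
  shows False
proof -
  have V: "x \<in> V" "x' \<in> V" "s \<in> V" "y \<in> V" using assms edge_in by auto
  have ne: "x \<noteq> x'" "s \<noteq> y" using assms by auto
  have o: "ord x \<noteq> ord s" "ord x' \<noteq> ord y" using assms V ord_neq by metis+
  have "E x s"
    using sc_right[of s x y] sc_right[of x s x'] assms V o edge_sym[of x' s] edge_sym[of s x]
    by (cases "ord x < ord s") auto
  moreover have "E x' y"
    using sc_left[of x' x y] sc_left[of y s x'] assms V o edge_sym[of x' s] edge_sym[of y x']
    by (cases "ord x' < ord y") auto
  ultimately show False
    using no_square[of x s x' y] assms(6,7) ne edge_sym[of x' s] edge_sym[of x y] by blast
qed

text \<open>In the class of \<open>c\<close>, the edge from \<open>w\<close> to \<open>s\<close>
  would cross \<open>c y\<close> or \<open>c z\<close>. In the class of \<open>s\<close>, either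
  \<open>w\<close> lies between \<open>y\<close> and \<open>z\<close>, so \<open>c\<close> is
  adjacent to it and there is a triangle, or \<open>y\<close> or \<open>z\<close> separates
  \<open>w\<close> from \<open>s\<close>.\<close>

lemma middle_leaf:
  assumes "E c y" "E c s" "E c z" "A y \<noteq> A c" "A s \<noteq> A c" "A z \<noteq> A c"
    "ord y < ord s" "ord s < ord z" "E s w"
  shows "w = c"
proof (rule ccontr)
  assume "w \<noteq> c"
  have V: "w \<in> V" "c \<in> V" using assms edge_in by auto
  show False
  proof (cases "A w = A c")
    case True
    then consider "ord w < ord c" | "ord c < ord w" using ord_neq[OF V \<open>w \<noteq> c\<close>] by linarith
    then show False
    proof cases
      case 1
      then show False using noncross[of w c y s] True assms edge_sym by auto
    next
      case 2
      then show False using noncross[of c w s z] True assms edge_sym by auto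
    qed
  next
    case False
    then have Aw: "A w = A s" using assms by auto
    have "\<not> E c w" using no_triangle[of c s w] assms by blast
    have "w \<noteq> y" "w \<noteq> z" using \<open>\<not> E c w\<close> assms by auto
    then have "ord w \<noteq> ord y" "ord w \<noteq> ord z" using V assms edge_in ord_neq by metis+
    then consider "ord w < ord y" | "ord y < ord w" "ord w < ord z" | "ord z < ord w" by linarith
    then show False
    proof cases
      case 1
      then show False using same_adj[of w s y] Aw assms edge_in edge_sym by metis
    next
      case 2
      then show False using consec[of c y z w] assms Aw V \<open>\<not> E c w\<close> by auto
    next
      case 3
      then show False using same_adj[of s w z] Aw assms edge_in by metis
    qed
  qed
qed

text \<open>The vertices of the class of \<open>c\<close> between \<open>c\<close> and \<open>a\<close> all lie on a path within that class.\<close>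

definition lane :: "'a \<Rightarrow> 'a \<Rightarrow> bool" where
  "lane c a \<longleftrightarrow> A a = A c \<and> ord c < ord a \<and>
    (\<forall>z\<in>V. A z = A c \<and> ord c \<le> ord z \<and> ord z \<le> ord a \<longrightarrow> (\<lambda>x y. E x y \<and> A x = A y)\<^sup>*\<^sup>* c z)"

lemma lane_edge:
  assumes "E c u" "A u = A c" "ord c < ord u"
  shows "lane c u"
  unfolding lane_def
proof (intro conjI ballI impI)
  fix z assume z: "z \<in> V" "A z = A c \<and> ord c \<le> ord z \<and> ord z \<le> ord u"
  have "z = c \<or> z = u"
    using same_adj[of c u z] z assms ord_neq[of z c] ord_neq[of z u] edge_in by fastforce
  then show "(\<lambda>x y. E x y \<and> A x = A y)\<^sup>*\<^sup>* c z" using assms by auto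
qed (use assms in auto)

lemma lane_extend:
  assumes "E c u" "A u = A c" "ord c < ord u" "lane u a"
  shows "lane c a"
  unfolding lane_def
proof (intro conjI ballI impI)
  fix z assume z: "z \<in> V" "A z = A c \<and> ord c \<le> ord z \<and> ord z \<le> ord a"
  show "(\<lambda>x y. E x y \<and> A x = A y)\<^sup>*\<^sup>* c z"
  proof (cases "ord z \<le> ord u")
    case True
    then show ?thesis using lane_edge[OF assms(1-3)] z unfolding lane_def by auto
  next
    case False
    then have "(\<lambda>x y. E x y \<and> A x = A y)\<^sup>*\<^sup>* u z"
      using assms z unfolding lane_def by auto
    moreover have "E c u \<and> A c = A u" using assms by simp
    ultimately show ?thesis by (rule converse_rtranclp_into_rtranclp[rotated])
  qed
qed (use assms in \<open>auto simp: lane_def\<close>)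

text \<open>The walk is followed until it leaves the class. This happens at the branching vertex at
  the latest: its place on the left is taken by its predecessor, and only one of its two further
  neighbours can be on the right.\<close>

lemma lane_med:
  assumes "med c u" "A u = A c" "ord c < ord u"
  shows "\<exists>a y. lane c a \<and> E a y \<and> A y \<noteq> A a"
  using assms
proof (induction rule: med_induct)
  case (tip c u x y)
  have right: "ord u < ord w" if "E u w" "w \<noteq> c" "A w = A u" for w
    using same_adj[of w u c] same_adj[of c u w] that tip ord_neq[of w u] ord_neq[of w c] edge_in
      edge_sym no_loop by (metis linorder_neqE_linordered_idom)
  have "A x \<noteq> A u \<or> A y \<noteq> A u"
    using right[of x] right[of y] tip same_right_unique[of u x y] by metis
  then show ?case using tip lane_edge by metis
next
  case (step c u v)
  show ?case
  proof (cases "A v = A u")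
    case True
    have "ord u < ord v"
      using same_adj[of v u c] same_adj[of c u v] True step ord_neq[of v u] ord_neq[of v c] edge_in
        edge_sym no_loop by (metis linorder_neqE_linordered_idom)
    then obtain a y where "lane u a" "E a y" "A y \<noteq> A a" using step True by auto
    then show ?thesis using lane_extend step by metis
  next
    case False
    then show ?thesis using lane_edge step by metis
  qed
qed

text \<open>Consider the edges \<open>a y\<close> and \<open>a1 y1\<close> at the ends of the lanes.
  They do not cross \<open>c b\<close>, so neither points back behind its start; they do not cross
  each other, so one of them ends inside the opposite lane. This joins \<open>c\<close> to
  \<open>b\<close> without the edge \<open>c b\<close>.\<close>

lemma no_two_lanes:
  assumes cb: "E c b" "A b \<noteq> A c"
    and a: "lane c a" "E a y" "A y \<noteq> A a"
    and y1: "lane b y1" "E y1 a1" "A a1 \<noteq> A y1"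
  shows False
proof -
  let ?R = "del_edge E c b"
  have same: "?R\<^sup>*\<^sup>* x z" if "(\<lambda>x y. E x y \<and> A x = A y)\<^sup>*\<^sup>* x z" for x z
    using that
  proof (induction rule: rtranclp_induct)
    case (step z w)
    then have "?R z w" using cb by (auto simp: del_edge_def doubleton_eq_iff)
    then show ?case using step by auto
  qed simp
  have cycle: False if "(\<lambda>x y. E x y \<and> A x = A y)\<^sup>*\<^sup>* c x" "E x z"
    "(\<lambda>x y. E x y \<and> A x = A y)\<^sup>*\<^sup>* b z" "x \<noteq> c \<or> z \<noteq> b" "x \<noteq> b" for x z
  proof -
    have "?R x z" using that by (auto simp: del_edge_def doubleton_eq_iff)
    then have "?R\<^sup>*\<^sup>* c b"
      using same[OF that(1)] del_edge_rtranclp_sym[OF same[OF that(3)]] by auto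
    then show False using bridge[OF cb(1)] by blast
  qed
  have V: "a \<in> V" "y \<in> V" "y1 \<in> V" "a1 \<in> V" "c \<in> V" "b \<in> V" using assms edge_in by auto
  have cl: "A a = A c" "A y = A b" "A y1 = A b" "A a1 = A c" and o: "ord c < ord a" "ord b < ord y1"
    using assms unfolding lane_def by auto
  have "ord b \<le> ord y" using noncross[of c a y b] cl o assms by fastforce
  have "ord c \<le> ord a1" using noncross[of b y1 a1 c] cl o assms edge_sym by fastforce
  show False
  proof (cases "ord a1 \<le> ord a")
    case True
    then show False
    proof (intro cycle[of a1 y1])
      show "(\<lambda>x y. E x y \<and> A x = A y)\<^sup>*\<^sup>* c a1"
        using a(1) cl V True \<open>ord c \<le> ord a1\<close> unfolding lane_def by blast
      show "(\<lambda>x y. E x y \<and> A x = A y)\<^sup>*\<^sup>* b y1"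
        using y1(1) V unfolding lane_def by auto
    qed (use cl o cb y1 edge_sym in auto)
  next
    case False
    then have "ord y \<le> ord y1" using noncross[of a a1 y1 y] cl assms edge_sym by fastforce
    show False
    proof (intro cycle[of a y])
      show "(\<lambda>x y. E x y \<and> A x = A y)\<^sup>*\<^sup>* c a"
        using a(1) V unfolding lane_def by auto
      show "(\<lambda>x y. E x y \<and> A x = A y)\<^sup>*\<^sup>* b y"
        using y1(1) cl V \<open>ord y \<le> ord y1\<close> \<open>ord b \<le> ord y\<close> unfolding lane_def by blast
    qed (use cl o cb a in auto)
  qed
qed

lemma no_two_right_med:
  assumes "E c b" "A b \<noteq> A c" "med c r" "A r = A c" "ord c < ord r"
    "med b v" "A v = A b" "ord b < ord v"
  shows False
proof -
  obtain y1 a1 where "lane b y1" "E y1 a1" "A a1 \<noteq> A y1" using lane_med assms(6-8) by blast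
  moreover obtain a y where "lane c a" "E a y" "A y \<noteq> A a" using lane_med assms(3-5) by blast
  ultimately show False using no_two_lanes[of c b a y y1 a1] assms by blast
qed

text \<open>Past \<open>c\<close>, the next place in its class is taken by \<open>s\<close>. If
  \<open>b\<close> were adjacent to \<open>s\<close> or to something beyond it,
  \<open>consec\<close> would give the triangle \<open>c\<close>, \<open>b\<close>,
  \<open>s\<close>.\<close>

lemma opposite_nbr_right:
  assumes "E c b" "A b \<noteq> A c" "E c s" "A s = A c" "ord c < ord s" "E b x" "A x \<noteq> A b"
  shows "ord x \<le> ord c"
proof (rule ccontr)
  assume "\<not> ord x \<le> ord c"
  then have "ord c < ord x" by simp
  have Ax: "A x = A c" and V: "x \<in> V" "s \<in> V" using assms edge_in by auto
  have "\<not> E b s" using no_triangle[of c b s] assms by blast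
  then have "ord x \<noteq> ord s" using ord_neq[OF V] assms by auto
  then show False
    using same_adj[of c s x] consec[of b c x s] assms V Ax edge_sym[of c b] \<open>\<not> E b s\<close> \<open>ord c < ord x\<close>
    by (cases "ord x < ord s") (auto dest: edge_in same_adj[of c s x])
qed

text \<open>As edges between the classes do not cross, \<open>b\<close> too can only continue to the right within its
  own class, so that there are two lanes to the right.\<close>

lemma no_right_corner:
  assumes s: "A s = A c" "ord c < ord s" "med c s"
    and b: "E c b" "A b \<noteq> A c" "E c d" "A d \<noteq> A c" "ord d < ord b" "med c b"
  shows False
proof -
  have Ecs: "E c s" using s med_edge by blast
  have V: "c \<in> V" "s \<in> V" "b \<in> V" "d \<in> V" using Ecs b edge_in by auto
  have nbr: "A x = A b \<and> ord b < ord x" if "E b x" "x \<noteq> c" for x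
  proof -
    have xV: "x \<in> V" using that edge_in by auto
    have "A x = A b"
    proof (rule ccontr)
      assume ne: "A x \<noteq> A b"
      then have Ax: "A x = A c" using b by auto
      have "ord x \<le> ord c" using opposite_nbr_right[OF b(1,2) Ecs s(1,2)] that ne by blast
      then have "ord x < ord c" using ord_neq[OF xV V(1) that(2)] by simp
      \<comment> \<open>Left of \<open>c\<close>, the edge \<open>x b\<close> crosses
        \<open>c d\<close>, because \<open>d\<close> is left of \<open>b\<close>.\<close>
      then show False using noncross[of x c d b] b Ax that edge_sym by auto
    qed
    moreover have "ord b < ord x"
    proof (rule ccontr)
      assume "\<not> ord b < ord x"
      then have "ord x < ord b" using ord_neq[OF xV V(3)] that no_loop by fastforce
      have "\<not> E c x" using no_triangle[of c b x] b that by blast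
      then have "ord x \<noteq> ord d" using ord_neq xV V b by metis
      then show False
        using same_adj[of x b d] consec[of c d b x] \<open>ord x < ord b\<close> \<open>A x = A b\<close> b V xV that
          \<open>\<not> E c x\<close> edge_sym by (metis linorder_neqE_linordered_idom)
    qed
    ultimately show ?thesis by blast
  qed
  \<comment> \<open>There is room for only one further neighbour of \<open>b\<close>, so its branch
    is medium only by continuing through that neighbour.\<close>
  obtain v where v: "E b v" "v \<noteq> c" "med b v"
    using med_cases[OF b(6)] nbr same_right_unique[of b] by metis
  then show False using no_two_right_med[of c b s v] b s nbr by blast
qed

lemma no_left_corner:
  assumes "A s = A c" "ord s < ord c" "med c s"
    "E c b" "A b \<noteq> A c" "E c d" "A d \<noteq> A c" "ord b < ord d" "med c b"
  shows False
  using strip.no_right_corner[OF mirror, of s c b d] assms by simp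

section \<open>Counting branches around a vertex\<close>

lemma same_left_unique:
  assumes "E c x" "E c y" "A x = A c" "A y = A c" "ord x < ord c" "ord y < ord c"
  shows "x = y"
  using strip.same_right_unique[OF mirror, of c x y] assms by simp

lemma ex_extreme_opposite:
  assumes "E c x" "A x \<noteq> A c"
  obtains d b where "E c d" "A d \<noteq> A c" "E c b" "A b \<noteq> A c"
    "\<And>u. E c u \<Longrightarrow> A u \<noteq> A c \<Longrightarrow> ord d \<le> ord u \<and> ord u \<le> ord b"
proof -
  let ?O = "{u \<in> V. E c u \<and> A u \<noteq> A c}"
  have O: "finite (ord ` ?O)" "ord ` ?O \<noteq> {}" using finite_V assms edge_in by auto
  obtain d where d: "d \<in> ?O" "ord d = Min (ord ` ?O)" using Min_in[OF O] by (metis (no_types, lifting) imageE)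
  obtain b where b: "b \<in> ?O" "ord b = Max (ord ` ?O)" using Max_in[OF O] by (metis (no_types, lifting) imageE)
  have "ord d \<le> ord u \<and> ord u \<le> ord b" if "E c u" "A u \<noteq> A c" for u
  proof -
    have "ord u \<in> ord ` ?O" using that edge_in by auto
    then show ?thesis unfolding d(2) b(2) using O(1) by (simp add: Min_le Max_ge)
  qed
  then show ?thesis using that d(1) b(1) by blast
qed

lemma opposite_nonleaf_extreme:
  assumes "E c d" "A d \<noteq> A c" "E c b" "A b \<noteq> A c"
    and bounds: "\<And>u. E c u \<Longrightarrow> A u \<noteq> A c \<Longrightarrow> ord d \<le> ord u \<and> ord u \<le> ord b"
    and u: "E c u" "A u \<noteq> A c" "E u w" "w \<noteq> c"
  shows "u = d \<or> u = b"
proof (rule ccontr)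
  assume "\<not> (u = d \<or> u = b)"
  then have "ord d < ord u" "ord u < ord b"
    using bounds[OF u(1,2)] ord_neq[of u d] ord_neq[of u b] assms edge_in by fastforce+
  then show False using middle_leaf[of c d u b w] assms by blast
qed

lemma same_nbr_side: "E c u \<Longrightarrow> ord c < ord u \<or> ord u < ord c"
  using ord_neq[of c u] edge_in no_loop by fastforce

text \<open>One neighbour on each side within the class, and the two extreme neighbours in the other
  class by \<open>middle_leaf\<close>. A place without a neighbour is filled arbitrarily.\<close>

lemma ex_four_nonleaf_nbrs:
  "\<exists>l r d b. \<forall>u w. E c u \<and> E u w \<and> w \<noteq> c \<longrightarrow> u \<in> {l, r, d, b}"
proof -
  have "\<exists>r. \<forall>u. E c u \<and> A u = A c \<and> ord c < ord u \<longrightarrow> u = r"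
    using same_right_unique by blast
  moreover have "\<exists>l. \<forall>u. E c u \<and> A u = A c \<and> ord u < ord c \<longrightarrow> u = l"
    using same_left_unique by blast
  moreover have "\<exists>d b. \<forall>u w. E c u \<and> A u \<noteq> A c \<and> E u w \<and> w \<noteq> c \<longrightarrow> u = d \<or> u = b"
  proof (cases "\<exists>x. E c x \<and> A x \<noteq> A c")
    case True
    then obtain d b where db: "E c d" "A d \<noteq> A c" "E c b" "A b \<noteq> A c"
      "\<And>u. E c u \<Longrightarrow> A u \<noteq> A c \<Longrightarrow> ord d \<le> ord u \<and> ord u \<le> ord b"
      using ex_extreme_opposite by metis
    then show ?thesis using opposite_nonleaf_extreme[OF db] by blast
  qed blast
  ultimately obtain l r d b where
    "\<forall>u. E c u \<and> A u = A c \<and> ord c < ord u \<longrightarrow> u = r"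
    "\<forall>u. E c u \<and> A u = A c \<and> ord u < ord c \<longrightarrow> u = l"
    "\<forall>u w. E c u \<and> A u \<noteq> A c \<and> E u w \<and> w \<noteq> c \<longrightarrow> u = d \<or> u = b" by blast
  then have "\<forall>u w. E c u \<and> E u w \<and> w \<noteq> c \<longrightarrow> u \<in> {l, r, d, b}"
    using same_nbr_side by blast
  then show ?thesis by blast
qed

lemma med_nonleaf: "med c u \<Longrightarrow> \<exists>w. E u w \<and> w \<noteq> c"
  using med_cases by blast

text \<open>Two opposite neighbours make the extremes \<open>d\<close> and \<open>b\<close>
  distinct. A medium branch to the right then excludes one at \<open>b\<close>, and one to the left
  excludes one at \<open>d\<close>: each of these two pairs of places holds at most one.\<close>

lemma no_three_med:
  assumes med: "med c u" "med c v" "med c w" and dist: "u \<noteq> v" "v \<noteq> w" "u \<noteq> w"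
    and opp: "E c x" "A x \<noteq> A c" "E c y" "A y \<noteq> A c" "x \<noteq> y"
  shows False
proof -
  obtain d b where db: "E c d" "A d \<noteq> A c" "E c b" "A b \<noteq> A c"
    "\<And>u. E c u \<Longrightarrow> A u \<noteq> A c \<Longrightarrow> ord d \<le> ord u \<and> ord u \<le> ord b"
    using ex_extreme_opposite[OF opp(1,2)] by metis
  have "ord x \<noteq> ord y" using ord_neq opp edge_in by metis
  then have lt: "ord d < ord b" using db(5)[of x] db(5)[of y] opp by linarith
  define R where "R z \<longleftrightarrow> med c z \<and> A z = A c \<and> ord c < ord z" for z
  define L where "L z \<longleftrightarrow> med c z \<and> A z = A c \<and> ord z < ord c" for z
  have type: "R z \<or> L z \<or> z = d \<or> z = b" if "med c z" for z
    using opposite_nonleaf_extreme[OF db] med_nonleaf[OF that] med_edge[OF that] same_nbr_side[of c z] that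
    unfolding R_def L_def by blast
  have "R z \<Longrightarrow> \<not> med c b" for z unfolding R_def using no_right_corner[of z c b d] db lt by blast
  moreover have "L z \<Longrightarrow> \<not> med c d" for z unfolding L_def using no_left_corner[of z c d b] db lt by blast
  moreover have "R z \<Longrightarrow> R z' \<Longrightarrow> z = z'" for z z'
    unfolding R_def using same_right_unique med_edge by blast
  moreover have "L z \<Longrightarrow> L z' \<Longrightarrow> z = z'" for z z'
    unfolding L_def using same_left_unique med_edge by blast
  ultimately show False using type[OF med(1)] type[OF med(2)] type[OF med(3)] med dist by metis
qed

text \<open>The three branches must start left, right and at the only opposite neighbour
  \<open>b\<close>. The vertices next to \<open>c\<close> on both sides confine the other neighbours
  of \<open>b\<close> to its own class, where there is room for two only; this rules out three
  leaves. A medium continuation of \<open>b\<close> would run parallel to the left or the right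
  branch.\<close>

lemma no_three_heavy_one_opposite:
  assumes heavy: "heavy c u" "heavy c v" "heavy c w" and dist: "u \<noteq> v" "v \<noteq> w" "u \<noteq> w"
    and one: "\<And>x y. E c x \<Longrightarrow> A x \<noteq> A c \<Longrightarrow> E c y \<Longrightarrow> A y \<noteq> A c \<Longrightarrow> x = y"
  shows False
proof -
  define R where "R z \<longleftrightarrow> heavy c z \<and> A z = A c \<and> ord c < ord z" for z
  define L where "L z \<longleftrightarrow> heavy c z \<and> A z = A c \<and> ord z < ord c" for z
  define B where "B z \<longleftrightarrow> heavy c z \<and> A z \<noteq> A c" for z
  have edge: "E c z" if "heavy c z" for z using that heavy_imp_med med_edge by blast
  have "R z \<or> L z \<or> B z" if "heavy c z" for z
    using same_nbr_side[OF edge[OF that]] that unfolding R_def L_def B_def by blast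
  moreover have "R z \<Longrightarrow> R z' \<Longrightarrow> z = z'" for z z'
    unfolding R_def using same_right_unique edge by blast
  moreover have "L z \<Longrightarrow> L z' \<Longrightarrow> z = z'" for z z'
    unfolding L_def using same_left_unique edge by blast
  moreover have "B z \<Longrightarrow> B z' \<Longrightarrow> z = z'" for z z'
    unfolding B_def using one edge by blast
  ultimately obtain r l b where rlb: "R r" "L l" "B b" using heavy dist by metis
  have r: "heavy c r" "A r = A c" "ord c < ord r" and l: "heavy c l" "A l = A c" "ord l < ord c"
    and b: "heavy c b" "A b \<noteq> A c"
    using rlb unfolding R_def L_def B_def by auto
  have same: "A x = A b" if "E b x" "x \<noteq> c" for x
  proof (rule ccontr)
    assume "A x \<noteq> A b"
    then have "ord x \<le> ord c" "- ord x \<le> - ord c"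
      using opposite_nbr_right[of c b r x] strip.opposite_nbr_right[OF mirror, of c b l x]
        r l b that edge by auto
    then show False using ord_neq[of x c] that edge edge_in b by fastforce
  qed
  show False
    using heavy_cases[OF b(1)]
  proof (elim disjE exE conjE)
    fix x y z assume xyz: "E b x" "E b y" "E b z" "distinct [x, y, z, c]"
    then show False
      using same_right_unique[of b] same_left_unique[of b] same[of x] same[of y] same[of z]
        same_nbr_side[of b x] same_nbr_side[of b y] same_nbr_side[of b z] by simp metis
  next
    fix v assume v: "E b v" "v \<noteq> c" "med b v"
    have E: "E c b" and medr: "med c r" and medl: "med c l"
      using r l b edge heavy_imp_med by auto
    show False
      using same_nbr_side[OF v(1)] no_two_right_med[OF E b(2) medr r(2,3) v(3) same[OF v(1,2)]]
        strip.no_two_right_med[OF mirror E b(2) medl l(2) _ v(3) same[OF v(1,2)]] l(3) by auto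
  qed
qed

lemma no_three_heavy:
  assumes "heavy c u" "heavy c v" "heavy c w" "u \<noteq> v" "v \<noteq> w" "u \<noteq> w"
  shows False
  using no_three_med[of c u v w] no_three_heavy_one_opposite[of c u v w] heavy_imp_med assms by blast

text \<open>The class of \<open>c\<close> holds at most two of its neighbours, so a fourth neighbour
  forces two opposite ones.\<close>

lemma no_three_med_degree_4:
  assumes "med c u" "med c v" "med c w" "E c x" "distinct [u, v, w, x]"
  shows False
proof -
  have E: "E c u" "E c v" "E c w" "E c x" using assms med_edge by auto
  have "\<exists>y z. E c y \<and> A y \<noteq> A c \<and> E c z \<and> A z \<noteq> A c \<and> y \<noteq> z"
  proof (rule ccontr)
    assume *: "\<not> ?thesis"
    define R where "R z \<longleftrightarrow> E c z \<and> A z = A c \<and> ord c < ord z" for z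
    define L where "L z \<longleftrightarrow> E c z \<and> A z = A c \<and> ord z < ord c" for z
    define B where "B z \<longleftrightarrow> E c z \<and> A z \<noteq> A c" for z
    have type: "R z \<or> L z \<or> B z" if "E c z" for z
      using same_nbr_side[OF that] that unfolding R_def L_def B_def by blast
    have "R z \<Longrightarrow> R z' \<Longrightarrow> z = z'" for z z'
      unfolding R_def using same_right_unique by blast
    moreover have "L z \<Longrightarrow> L z' \<Longrightarrow> z = z'" for z z'
      unfolding L_def using same_left_unique by blast
    moreover have "B z \<Longrightarrow> B z' \<Longrightarrow> z = z'" for z z'
      unfolding B_def using * by blast
    ultimately show False
      using type[OF E(1)] type[OF E(2)] type[OF E(3)] type[OF E(4)] assms(5) by simp metis
  qed
  then show False using no_three_med[of c u v w] assms by auto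
qed

lemma no_five_nonleaf_nbrs:
  assumes "finite S" "\<And>u. u \<in> S \<Longrightarrow> leg E c u 1 1"
  shows "card S \<le> 4"
proof -
  obtain l r d b where four: "\<forall>u w. E c u \<and> E u w \<and> w \<noteq> c \<longrightarrow> u \<in> {l, r, d, b}"
    using ex_four_nonleaf_nbrs by blast
  have "S \<subseteq> {l, r, d, b}"
  proof
    fix u assume "u \<in> S"
    then have leg: "leg E c u (Suc 0) 1" using assms(2) by simp
    then obtain T where "card T = 1" "c \<notin> T" "\<forall>x\<in>T. E u x" by (rule leg_tip_cases)
    then show "u \<in> {l, r, d, b}" using four leg_edge[OF leg] by (auto simp: card_1_singleton_iff)
  qed
  then have "card S \<le> card {l, r, d, b}" by (intro card_mono) auto
  also have "\<dots> \<le> 4" by (simp add: card_insert_if)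
  finally show ?thesis .
qed

end

section \<open>Orderings with two classes exclude the spiders\<close>

definition two_class_ordering :: "'a set \<Rightarrow> ('a \<Rightarrow> 'a \<Rightarrow> bool) \<Rightarrow> bool" where
  "two_class_ordering V E \<longleftrightarrow>
    (\<exists>ord cls. inj_on ord V \<and> cls ` V \<subseteq> {..<2} \<and> strongly_consistent V E ord cls)"

context tree
begin

text \<open>\<open>A\<close> only has to induce the same partition as \<open>cls\<close>, so that a
  constant \<open>A\<close> handles orderings with a single class.\<close>

lemma strip_of_ordering:
  assumes "inj_on ord V" "strongly_consistent V E ord cls"
    and eq: "\<And>x y. x \<in> V \<Longrightarrow> y \<in> V \<Longrightarrow> cls x = cls y \<longleftrightarrow> A x = A y"
  shows "strip V E (\<lambda>x. int (ord x)) A"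
proof
  show "inj_on (\<lambda>x. int (ord x)) V" using assms(1) by (auto simp: inj_on_def)
  fix r s t
  assume *: "s \<in> V" "int (ord r) < int (ord s)" "int (ord s) < int (ord t)" "E r t"
  have "r \<in> V" "t \<in> V" using * edge_in by auto
  have "(cls r = cls s \<longrightarrow> E s t) \<and> (cls s = cls t \<longrightarrow> E r s)"
    using assms(2) \<open>r \<in> V\<close> \<open>s \<in> V\<close> \<open>t \<in> V\<close> * unfolding strongly_consistent_def
    by (metis of_nat_less_iff)
  then show "A r = A s \<Longrightarrow> E s t" "A s = A t \<Longrightarrow> E r s"
    using eq \<open>r \<in> V\<close> \<open>s \<in> V\<close> \<open>t \<in> V\<close> by blast+
qed

lemma ex_strip:
  assumes "two_class_ordering V E"
  shows "\<exists>ord A. strip V E ord A"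
proof -
  obtain ord cls where o: "inj_on ord V" "cls ` V \<subseteq> {..<2}" "strongly_consistent V E ord cls"
    using assms unfolding two_class_ordering_def by blast
  have "cls x = cls y \<longleftrightarrow> (cls x = 0) = (cls y = 0)" if "x \<in> V" "y \<in> V" for x y
  proof -
    have "cls x < 2" "cls y < 2" using o(2) that by auto
    then show ?thesis by auto
  qed
  then show ?thesis using strip_of_ordering[OF o(1,3), of "\<lambda>x. cls x = 0"] by blast
qed

lemma two_class_ordering_no_three_heavy:
  assumes "two_class_ordering V E" "heavy c u" "heavy c v" "heavy c w" "u \<noteq> v" "v \<noteq> w" "u \<noteq> w"
  shows False
  using ex_strip[OF assms(1)] strip.no_three_heavy assms(2-) by metis

lemma has_spider_3_legs:
  assumes "has_spider V E [(i, m), (j, n), (k, p)]" "1 \<le> i" "1 \<le> j" "1 \<le> k"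
  shows "\<exists>c u v w. leg E c u i m \<and> leg E c v j n \<and> leg E c w k p \<and> u \<noteq> v \<and> v \<noteq> w \<and> u \<noteq> w"
proof -
  have "1 \<le> fst ([(i, m), (j, n), (k, p)] ! b)" if "b < length [(i, m), (j, n), (k, p)]" for b
    using that assms(2-) by (auto simp: less_Suc_eq nth_Cons')
  from has_spider_legs[OF assms(1) this] obtain c us where us: "distinct us" "length us = 3"
    "\<forall>b<3. leg E c (us ! b) (fst ([(i, m), (j, n), (k, p)] ! b)) (snd ([(i, m), (j, n), (k, p)] ! b))"
    by (auto simp: numeral_3_eq_3)
  then obtain u v w where uvw: "us = [u, v, w]" by (auto simp: length_Suc_conv numeral_3_eq_3)
  have "leg E c u i m" "leg E c v j n" "leg E c w k p"
    using us(3)[rule_format, of 0] us(3)[rule_format, of 1] us(3)[rule_format, of 2] uvw by simp_all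
  then show ?thesis using us(1) uvw by auto
qed

lemma heavy_leg_1: "leg E c u 1 3 \<Longrightarrow> heavy c u"
  and heavy_leg_2: "2 \<le> i \<Longrightarrow> leg E c u i 2 \<Longrightarrow> heavy c u"
  unfolding heavy_def by auto

lemma two_class_ordering_no_spiders:
  assumes "two_class_ordering V E"
  shows "\<not> has_spider V E T0"
    and "\<not> has_spider V E T1"
    and "2 \<le> i \<Longrightarrow> 2 \<le> j \<Longrightarrow> 2 \<le> k \<Longrightarrow> \<not> has_spider V E (T2 i j k)"
    and "2 \<le> i \<Longrightarrow> 2 \<le> j \<Longrightarrow> \<not> has_spider V E (T3 i j)"
    and "2 \<le> i \<Longrightarrow> \<not> has_spider V E (T4 i)"
    and "1 \<le> i \<Longrightarrow> 1 \<le> j \<Longrightarrow> \<not> has_spider V E (T5 i j)"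
proof -
  note no_heavy = two_class_ordering_no_three_heavy[OF assms] and heavy = heavy_leg_1 heavy_leg_2
  obtain ord A where "strip V E ord A" using ex_strip[OF assms] by blast
  then interpret strip V E ord A .
  show "\<not> has_spider V E T0"
  proof
    assume "has_spider V E T0"
    then obtain c us where us: "distinct us" "length us = length T0"
      "\<forall>b<length T0. leg E c (us ! b) (fst (T0 ! b)) (snd (T0 ! b))"
      using has_spider_legs[of V E T0] by (auto simp: T0_def)
    then have "leg E c u 1 1" if "u \<in> set us" for u
      using that by (auto simp: T0_def in_set_conv_nth)
    then have "card (set us) \<le> 4" using no_five_nonleaf_nbrs[of "set us" c] by simp
    then show False using us by (simp add: distinct_card T0_def)
  qed
  have "T1 = [(1, 3), (1, 3), (1, 3)]" by (simp add: T1_def numeral_3_eq_3)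
  then show "\<not> has_spider V E T1"
    using has_spider_3_legs[of 1 3 1 3 1 3] heavy no_heavy by (metis order.refl)
  show "\<not> has_spider V E (T2 i j k)" if "2 \<le> i" "2 \<le> j" "2 \<le> k"
    using has_spider_3_legs[of i 2 j 2 k 2] heavy no_heavy that unfolding T2_def
    by (meson one_le_numeral order.trans)
  show "\<not> has_spider V E (T3 i j)" if "2 \<le> i" "2 \<le> j"
    using has_spider_3_legs[of 1 3 i 2 j 2] heavy no_heavy that unfolding T3_def
    by (meson one_le_numeral order.trans order.refl)
  show "\<not> has_spider V E (T4 i)" if "2 \<le> i"
    using has_spider_3_legs[of 1 3 1 3 i 2] heavy no_heavy that unfolding T4_def
    by (meson one_le_numeral order.trans order.refl)
  show "\<not> has_spider V E (T5 i j)" if "1 \<le> i" "1 \<le> j"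
  proof
    assume "has_spider V E (T5 i j)"
    moreover have "1 \<le> fst (T5 i j ! b)" if "b < length (T5 i j)" for b
      using that \<open>1 \<le> i\<close> \<open>1 \<le> j\<close> by (auto simp: T5_def less_Suc_eq nth_Cons')
    ultimately obtain c us where us: "distinct us" "length us = length (T5 i j)"
      "\<forall>b<length (T5 i j). leg E c (us ! b) (fst (T5 i j ! b)) (snd (T5 i j ! b))"
      using has_spider_legs[of V E "T5 i j"] by blast
    then obtain x u v w where uvw: "us = [x, u, v, w]"
      by (auto simp: T5_def length_Suc_conv numeral_eq_Suc)
    have "leg E c x 1 0" "leg E c u 1 2" "leg E c v i 2" "leg E c w j 2"
      using us(3)[rule_format, of 0] us(3)[rule_format, of 1] us(3)[rule_format, of 2]
        us(3)[rule_format, of 3] uvw by (simp_all add: T5_def)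
    then show False
      using no_three_med_degree_4[of c u v w x] us(1) uvw leg_edge[of E c x] unfolding med_def by auto
  qed
qed

end


section \<open>Strongly consistent lists\<close>

definition consistent_triple ::
    "('a \<Rightarrow> 'a \<Rightarrow> bool) \<Rightarrow> 'a set \<Rightarrow> 'a \<Rightarrow> 'a \<Rightarrow> 'a \<Rightarrow> bool" where
  "consistent_triple E A r s t \<longleftrightarrow>
    (E r t \<longrightarrow> ((r \<in> A \<longleftrightarrow> s \<in> A) \<longrightarrow> E s t) \<and> ((s \<in> A \<longleftrightarrow> t \<in> A) \<longrightarrow> E r s))"

text \<open>The list is the ordering; the two classes are \<open>A\<close> and its complement.\<close>

primrec consistent_list :: "('a \<Rightarrow> 'a \<Rightarrow> bool) \<Rightarrow> 'a set \<Rightarrow> 'a list \<Rightarrow> bool" where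
  "consistent_list E A [] \<longleftrightarrow> True"
| "consistent_list E A (r # L) \<longleftrightarrow>
    sorted_wrt (consistent_triple E A r) L \<and> consistent_list E A L"

lemma consistent_list_append:
  "consistent_list E A (L1 @ L2) \<longleftrightarrow> consistent_list E A L1 \<and> consistent_list E A L2 \<and>
    (\<forall>r\<in>set L1. sorted_wrt (consistent_triple E A r) L2) \<and>
    (\<forall>t\<in>set L2. sorted_wrt (\<lambda>r s. consistent_triple E A r s t) L1)"
  by (induction L1) (auto simp: sorted_wrt_append)

lemma consistent_list_rev:
  assumes "\<And>x y. E x y \<Longrightarrow> E y x"
  shows "consistent_list E A (rev L) \<longleftrightarrow> consistent_list E A L"
proof (induction L)
  case (Cons a L)
  have "consistent_triple E A r s t = consistent_triple E A t s r" for r s t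
    using assms unfolding consistent_triple_def by metis
  then have "(\<lambda>s r. consistent_triple E A r s a) = consistent_triple E A a" by blast
  then show ?case using Cons by (auto simp: consistent_list_append sorted_wrt_rev)
qed simp

lemma consistent_triple_cong:
  "A \<inter> X = B \<inter> X \<Longrightarrow> {r, s, t} \<subseteq> X \<Longrightarrow> consistent_triple E A r s t = consistent_triple E B r s t"
  unfolding consistent_triple_def by blast

lemma consistent_list_cong:
  "A \<inter> set L = B \<inter> set L \<Longrightarrow> consistent_list E A L \<Longrightarrow> consistent_list E B L"
proof (induction L)
  case (Cons a L)
  then have "consistent_list E B L" by auto
  moreover have "sorted_wrt (consistent_triple E B a) L"
  proof (rule sorted_wrt_mono_rel)
    show "sorted_wrt (consistent_triple E A a) L" using Cons.prems by simp
    fix s t assume "s \<in> set L" "t \<in> set L" "consistent_triple E A a s t"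
    then show "consistent_triple E B a s t"
      using consistent_triple_cong[OF Cons.prems(1), of a s t E] by simp
  qed
  ultimately show ?case by simp
qed simp

lemma consistent_list_no_edges:
  "(\<And>r t. r \<in> set L \<Longrightarrow> t \<in> set L \<Longrightarrow> \<not> E r t) \<Longrightarrow> consistent_list E A L"
proof (induction L)
  case (Cons a L)
  have "sorted_wrt (consistent_triple E A a) L"
    by (rule sorted_wrt_mono_rel[of _ "\<lambda>_ _. True"])
      (use Cons.prems in \<open>auto simp: consistent_triple_def sorted_wrt_iff_nth_less\<close>)
  then show ?case using Cons by auto
qed simp

text \<open>Only pairs ending in \<open>y\<close> carry a condition, and \<open>y\<close> occurs
  once, so just the elements in front of it matter.\<close>

lemma sorted_wrt_before:
  assumes "distinct (pre @ y # post)" "\<And>t. t \<in> set (pre @ y # post) \<Longrightarrow> t \<noteq> y \<Longrightarrow> \<forall>s. P s t"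
    "\<And>s. s \<in> set pre \<Longrightarrow> P s y"
  shows "sorted_wrt P (pre @ y # post)"
proof -
  have "sorted_wrt P pre" "sorted_wrt P post"
    by (rule sorted_wrt_mono_rel[of _ "\<lambda>_ _. True"];
        use assms(1,2) in \<open>force simp: sorted_wrt_iff_nth_less\<close>)+
  then show ?thesis using assms by (auto simp: sorted_wrt_append)
qed

text \<open>In a triple meeting both lists, only \<open>x y\<close> can be the edge between first
  and last vertex. It remains to test the vertices strictly between \<open>x\<close> and
  \<open>y\<close>.\<close>

lemma consistent_list_glue:
  assumes dist: "distinct (pre1 @ x # post1)" "distinct (pre2 @ y # post2)"
    and cons: "consistent_list E A (pre1 @ x # post1)" "consistent_list E A (pre2 @ y # post2)"
    and edge: "\<And>r t. r \<in> set (pre1 @ x # post1) \<Longrightarrow> t \<in> set (pre2 @ y # post2) \<Longrightarrow> E r t \<Longrightarrow> r = x \<and> t = y"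
    and between: "\<And>s. s \<in> set post1 \<union> set pre2 \<Longrightarrow> consistent_triple E A x s y"
  shows "consistent_list E A ((pre1 @ x # post1) @ (pre2 @ y # post2))"
  unfolding consistent_list_append[of E A "pre1 @ x # post1"]
proof (intro conjI ballI)
  fix r assume r: "r \<in> set (pre1 @ x # post1)"
  show "sorted_wrt (consistent_triple E A r) (pre2 @ y # post2)"
  proof (rule sorted_wrt_before[OF dist(2)])
    fix s assume "s \<in> set pre2"
    show "consistent_triple E A r s y"
    proof (cases "E r y")
      case True
      then have "r = x" using edge[OF r _ True] by simp
      then show ?thesis using between[of s] \<open>s \<in> set pre2\<close> by simp
    qed (simp add: consistent_triple_def)
  next
    fix t assume "t \<in> set (pre2 @ y # post2)" "t \<noteq> y"
    then have "\<not> E r t" using edge[OF r, of t] by blast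
    then show "\<forall>s. consistent_triple E A r s t" by (simp add: consistent_triple_def)
  qed
next
  fix t assume t: "t \<in> set (pre2 @ y # post2)"
  \<comment> \<open>Reversal makes \<open>x\<close> the second component of the pair, as
    \<open>sorted_wrt_before\<close> requires.\<close>
  have "sorted_wrt (\<lambda>s r. consistent_triple E A r s t) (rev post1 @ x # rev pre1)"
  proof (rule sorted_wrt_before)
    fix s assume "s \<in> set (rev post1)"
    show "consistent_triple E A x s t"
    proof (cases "E x t")
      case True
      then have "t = y" using edge[OF _ t True] by simp
      then show ?thesis using between[of s] \<open>s \<in> set (rev post1)\<close> by simp
    qed (simp add: consistent_triple_def)
  next
    fix r assume "r \<in> set (rev post1 @ x # rev pre1)" "r \<noteq> x"
    then have "r \<in> set (pre1 @ x # post1)" by auto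
    then have "\<not> E r t" using edge[OF _ t, of r] \<open>r \<noteq> x\<close> by blast
    then show "\<forall>s. consistent_triple E A r s t" by (simp add: consistent_triple_def)
  qed (use dist(1) in auto)
  then show "sorted_wrt (\<lambda>r s. consistent_triple E A r s t) (pre1 @ x # post1)"
    using sorted_wrt_rev[of "\<lambda>s r. consistent_triple E A r s t" "pre1 @ x # post1"] by simp
qed (use cons in auto)

lemma consistent_list_glue_ends:
  assumes "distinct L1" "distinct L2" "consistent_list E A L1" "consistent_list E A L2"
    and edge: "\<And>r t. r \<in> set L1 \<Longrightarrow> t \<in> set L2 \<Longrightarrow> E r t \<Longrightarrow> r = last L1 \<and> t = hd L2"
  shows "consistent_list E A (L1 @ L2)"
proof (cases "L1 = [] \<or> L2 = []")
  case False
  then obtain pre1 x y post2 where L: "L1 = pre1 @ x # []" "L2 = [] @ y # post2"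
    by (metis append_Nil list.exhaust rev_exhaust)
  show ?thesis unfolding L
  proof (rule consistent_list_glue)
    fix r t assume "r \<in> set (pre1 @ x # [])" "t \<in> set ([] @ y # post2)" "E r t"
    then have "r = last L1 \<and> t = hd L2" using edge[of r t] unfolding L by blast
    then show "r = x \<and> t = y" unfolding L by simp
  qed (use assms(1-4) L in simp_all)
qed (use assms(3,4) in auto)

lemma consistent_list_nth:
  "consistent_list E A L \<Longrightarrow> i < j \<Longrightarrow> j < k \<Longrightarrow> k < length L \<Longrightarrow>
    consistent_triple E A (L ! i) (L ! j) (L ! k)"
proof (induction L arbitrary: i j k)
  case (Cons a L)
  show ?case
  proof (cases i)
    case 0
    have "sorted_wrt (consistent_triple E A a) L" using Cons.prems by simp
    then have "consistent_triple E A a (L ! (j - 1)) (L ! (k - 1))"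
      by (rule sorted_wrt_nth_less) (use Cons.prems 0 in auto)
    then show ?thesis using Cons.prems 0 by (simp add: nth_Cons')
  next
    case (Suc i')
    then show ?thesis using Cons.IH[of i' "j - 1" "k - 1"] Cons.prems by (simp add: nth_Cons')
  qed
qed simp

lemma consistent_list_imp_ordering:
  assumes "distinct L" "set L = V" "consistent_list E A L"
  shows "\<exists>ord. inj_on ord V \<and> strongly_consistent V E ord (\<lambda>x. if x \<in> A then 0 else 1)"
proof -
  define ord where "ord x = (THE i. i < length L \<and> L ! i = x)" for x
  have ord: "ord x < length L \<and> L ! ord x = x" if "x \<in> V" for x
  proof -
    have "\<exists>!i. i < length L \<and> L ! i = x"
      using distinct_Ex1[OF assms(1)] that assms(2) by simp
    then show ?thesis unfolding ord_def by (rule theI')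
  qed
  have "inj_on ord V" using ord by (metis inj_onI)
  moreover have "strongly_consistent V E ord (\<lambda>x. if x \<in> A then 0 else 1)"
    unfolding strongly_consistent_def
  proof (intro ballI impI)
    fix r s t assume "r \<in> V" "s \<in> V" "t \<in> V" and *: "ord r < ord s \<and> ord s < ord t \<and> E r t"
    then have "consistent_triple E A r s t"
      using consistent_list_nth[OF assms(3), of "ord r" "ord s" "ord t"]
        ord[of r] ord[of s] ord[of t] by simp
    then show "((if r \<in> A then 0 else 1) = (if s \<in> A then 0 else (1::nat)) \<longrightarrow> E s t) \<and>
        ((if s \<in> A then 0 else 1) = (if t \<in> A then 0 else (1::nat)) \<longrightarrow> E r s)"
      using * unfolding consistent_triple_def by simp
  qed
  ultimately show ?thesis by blast
qed

section \<open>Constructing an ordering\<close>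

context tree
begin

text \<open>From here on \<open>leg E u w 1 1\<close> expresses that \<open>w\<close> is a non-leaf
  neighbour of \<open>u\<close>.\<close>

lemma nonleaf_intro: "E u w \<Longrightarrow> E w x \<Longrightarrow> x \<noteq> u \<Longrightarrow> leg E u w 1 1"
  using leg.tip[of E u w "{x}" 1] by simp

lemma med_imp_nonleaf: "med u w \<Longrightarrow> leg E u w 1 1"
  using med_cases nonleaf_intro med_edge by metis

lemma consistent_list_rev_iff: "consistent_list E A (rev L) \<longleftrightarrow> consistent_list E A L"
  by (rule consistent_list_rev) (rule edge_sym)

lemma br_leaf:
  assumes "E u w" "\<not> leg E u w 1 1"
  shows "br u w = {w}"
proof -
  have no_child: "{x. E w x \<and> x \<noteq> u} = {}" using nonleaf_intro[OF assms(1)] assms(2) by blast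
  show ?thesis unfolding br_unfold[OF assms(1)] no_child by simp
qed

lemma br_entry: "E u w \<Longrightarrow> t \<in> br u w \<Longrightarrow> E r t \<Longrightarrow> r \<notin> br u w \<Longrightarrow> t = w \<and> r = u"
  using br_exit[of u w t r] edge_sym by blast

text \<open>Without two children anywhere the branch is a path. Listed in path order no vertex lies
  between the ends of an edge, so the classes may be chosen freely later.\<close>

lemma ex_bare_path_list:
  assumes "E u q" "\<not> med u q"
  shows "\<exists>Q. distinct (q # Q) \<and> set (q # Q) = br u q \<and> (\<forall>A. consistent_list E A (q # Q))"
  using assms
proof (induction "card (br u q)" arbitrary: u q rule: less_induct)
  case less
  show ?case
  proof (cases "\<exists>v. E q v \<and> v \<noteq> u")
    case False
    then have "br u q = {q}" using br_unfold[OF less.prems(1)] by auto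
    then show ?thesis by (intro exI[of _ "[]"]) simp
  next
    case True
    then obtain v where v: "E q v" "v \<noteq> u" by blast
    have unique: "w = v" if "E q w" "w \<noteq> u" for w
      using med_tip[OF less.prems(1) v(1) that(1)] v that less.prems by blast
    have "\<not> med q v" using med_step[OF less.prems(1) v] less.prems heavy_imp_med by blast
    moreover have "card (br q v) < card (br u q)" using br_psubset less.prems v by blast
    ultimately obtain Q where Q: "distinct (v # Q)" "set (v # Q) = br q v"
      "\<forall>A. consistent_list E A (v # Q)"
      using less.hyps v by blast
    have "{w. E q w \<and> w \<noteq> u} = {v}" using unique v by blast
    then have br: "br u q = insert q (br q v)" using br_unfold[OF less.prems(1)] by simp
    have "q \<notin> br q v" using root_notin_br v by blast
    moreover have "consistent_list E A ([q] @ (v # Q))" for A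
    proof (rule consistent_list_glue_ends)
      fix r t assume "r \<in> set [q]" "t \<in> set (v # Q)" "E r t"
      then have "t \<in> br q v" "r \<notin> br q v" using Q(2) \<open>q \<notin> br q v\<close> by auto
      then show "r = last [q] \<and> t = hd (v # Q)"
        using br_entry[OF v(1) _ \<open>E r t\<close>] by simp
    qed (use Q in auto)
    ultimately show ?thesis using Q br by (intro exI[of _ "v # Q"]) auto
  qed
qed

lemma ex_bare_path_list_opt:
  assumes "\<And>w. w \<in> N \<Longrightarrow> E u w \<and> \<not> med u w" "finite N" "card N \<le> 1"
  shows "\<exists>Q. distinct Q \<and> set Q = (\<Union>w\<in>N. br u w) \<and> (\<forall>A. consistent_list E A Q) \<and>
    (\<forall>t\<in>set Q. E u t \<longrightarrow> t = hd Q)"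
proof (cases "N = {}")
  case True
  then show ?thesis by (intro exI[of _ "[]"]) simp
next
  case False
  then have "card N = 1" using assms(2,3) by (metis One_nat_def Suc_leI card_gt_0_iff le_antisym)
  then obtain w where w: "N = {w}" by (auto simp: card_1_singleton_iff)
  then have E: "E u w" "\<not> med u w" using assms(1) by auto
  from ex_bare_path_list[OF this] obtain Q where Q: "distinct (w # Q)" "set (w # Q) = br u w"
    "\<forall>A. consistent_list E A (w # Q)" by blast
  have "t = hd (w # Q)" if "t \<in> set (w # Q)" "E u t" for t
    using br_entry[OF E(1) _ that(2) root_notin_br[OF E(1)]] that(1) unfolding Q(2) by simp
  then show ?thesis using Q w by (intro exI[of _ "w # Q"]) auto
qed

text \<open>The order is: first path reversed, \<open>u\<close>, the leaves, second path. Both paths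
  turn their first vertex towards \<open>u\<close>. The leaves lie under the edge from
  \<open>u\<close> to the second path; they do no harm, being adjacent to \<open>u\<close> and in
  the other class. The bound 2 is four minus the two spine neighbours.\<close>

lemma ex_block_bare:
  assumes S: "\<And>w. w \<in> S \<Longrightarrow> E u w \<and> \<not> med u w" and card: "card {w \<in> S. leg E u w 1 1} \<le> 2"
  shows "\<exists>pre post. distinct (pre @ u # post) \<and>
    set (pre @ u # post) = insert u (\<Union>w\<in>S. br u w) \<and> consistent_list E {u} (pre @ u # post)"
proof -
  define N where "N = {w \<in> S. leg E u w 1 1}"
  have "S \<subseteq> V" using S edge_in by blast
  then have fin: "finite S" using finite_V finite_subset by blast
  \<comment> \<open>Halving leaves at most one path on each side, whether there are zero, one or
    two.\<close>
  obtain N1 where N1: "N1 \<subseteq> N" "card N1 = card N div 2"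
    using obtain_subset_with_card_n[of "card N div 2" N] by auto
  define N2 where "N2 = N - N1"
  have finN: "finite N" "finite N1" "finite N2"
    using fin finite_subset[OF N1(1)] unfolding N_def N2_def by auto
  have card12: "card N1 \<le> 1" "card N2 \<le> 1"
    using N1 card card_Diff_subset[OF finN(2) N1(1)] unfolding N2_def N_def by auto
  obtain Q1 where Q1: "distinct Q1" "set Q1 = (\<Union>w\<in>N1. br u w)" "\<forall>A. consistent_list E A Q1"
    "\<forall>t\<in>set Q1. E u t \<longrightarrow> t = hd Q1"
    using ex_bare_path_list_opt[of N1 u] S N1 finN card12 unfolding N_def by blast
  obtain Q2 where Q2: "distinct Q2" "set Q2 = (\<Union>w\<in>N2. br u w)" "\<forall>A. consistent_list E A Q2"
    "\<forall>t\<in>set Q2. E u t \<longrightarrow> t = hd Q2"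
    using ex_bare_path_list_opt[of N2 u] S finN card12 unfolding N2_def N_def by blast
  obtain M where M: "set M = S - N" "distinct M"
    using finite_distinct_list[of "S - N"] fin by blast
  have leaf: "E u m" "br u m = {m}" if "m \<in> set M" for m
    using that M S br_leaf[of u m] unfolding N_def by auto
  have E: "E u w" if "w \<in> N1 \<or> w \<in> N2 \<or> w \<in> set M" for w
    using that S N1 M unfolding N2_def N_def by blast
  have "u \<notin> br u w" if "w \<in> S" for w using root_notin_br S that by blast
  moreover have sub: "N1 \<subseteq> S" "N2 \<subseteq> S" "set M \<subseteq> S"
    using M N1(1) unfolding N2_def N_def by auto
  ultimately have u: "u \<notin> set Q1" "u \<notin> set Q2" unfolding Q1(2) Q2(2) by blast+
  have uM: "u \<notin> set M" using sub(3) S no_loop by blast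
  have disj: "x \<notin> br u w'" if "x \<in> br u w" "E u w" "E u w'" "w \<noteq> w'" for x w w'
    using br_disjoint[OF that(2-4)] that(1) by blast
  have "N1 \<inter> N2 = {}" "N1 \<inter> set M = {}" "N2 \<inter> set M = {}"
    using M N1(1) unfolding N2_def by auto
  note sep = this
  have "set Q1 \<inter> set Q2 = {}"
    unfolding Q1(2) Q2(2) using disj E sep(1) by blast
  moreover have "m \<notin> set Q1" "m \<notin> set Q2" if m: "m \<in> set M" for m
  proof -
    have "m \<notin> br u w" if "w \<in> N1 \<union> N2" for w
    proof (rule disj)
      show "m \<noteq> w" using sep m that by blast
      show "m \<in> br u m" by simp
    qed (use E m that in auto)
    then show "m \<notin> set Q1" "m \<notin> set Q2" unfolding Q1(2) Q2(2) by auto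
  qed
  ultimately have dist: "distinct (u # M @ Q2)" "distinct (rev Q1 @ u # M @ Q2)"
    using u uM Q1(1) Q2(1) M(2) by auto
  \<comment> \<open>Leaving a branch at \<open>u\<close> is possible only towards
    \<open>u\<close>.\<close>
  have to_u: "t = u" if r: "r \<in> set Q1 \<or> r \<in> set M \<or> r \<in> set Q2" and rt: "E r t"
    and not1: "\<not> (r \<in> set Q1 \<and> t \<in> set Q1)" and not2: "\<not> (r \<in> set Q2 \<and> t \<in> set Q2)" for r t
  proof -
    consider (Q1) "r \<in> set Q1" | (M) "r \<in> set M" | (Q2) "r \<in> set Q2" using r by blast
    then show ?thesis
    proof cases
      case Q1
      then obtain w where w: "w \<in> N1" "r \<in> br u w" "t \<notin> br u w"
        using not1 unfolding \<open>set Q1 = _\<close> by blast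
      then show ?thesis using br_exit(2)[OF _ w(2) rt w(3)] E by blast
    next
      case M
      then have "r \<in> br u r" "t \<notin> br u r" using leaf(2)[OF M] rt no_loop by auto
      then show ?thesis using br_exit(2)[OF leaf(1)[OF M] _ rt] by blast
    next
      case Q2
      then obtain w where w: "w \<in> N2" "r \<in> br u w" "t \<notin> br u w"
        using not2 unfolding \<open>set Q2 = _\<close> by blast
      then show ?thesis using br_exit(2)[OF _ w(2) rt w(3)] E by blast
    qed
  qed
  have "consistent_list E {u} M"
  proof (rule consistent_list_no_edges)
    fix r t assume "r \<in> set M" "t \<in> set M"
    moreover from this have "r \<notin> set Q1" "r \<notin> set Q2" "t \<noteq> u" using dist(2) by auto
    ultimately show "\<not> E r t" using to_u[of r t] by blast
  qed
  moreover have "sorted_wrt (consistent_triple E {u} u) M"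
    unfolding sorted_wrt_iff_nth_less consistent_triple_def using leaf(1) uM
    by (metis length_append_singleton nth_mem order.strict_trans singleton_iff)
  ultimately have cons_uM: "consistent_list E {u} ([] @ u # M)" by simp
  have "consistent_list E {u} (u # M @ Q2)"
  proof (cases Q2)
    case Nil
    then show ?thesis using cons_uM by simp
  next
    case (Cons y Q2')
    have "consistent_list E {u} (([] @ u # M) @ ([] @ y # Q2'))"
    proof (rule consistent_list_glue)
      fix r t assume rt: "r \<in> set ([] @ u # M)" "t \<in> set ([] @ y # Q2')" "E r t"
      then have t: "t \<in> set Q2" using Cons by simp
      then have "t \<noteq> u" "r \<notin> set Q1 \<and> r \<notin> set Q2" using dist(2) rt(1) by auto
      then have "r = u" using to_u[of r t] rt by auto
      moreover have "t = hd Q2" using Q2(4) t rt(3) \<open>r = u\<close> by blast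
      then have "t = y" using Cons by simp
      ultimately show "r = u \<and> t = y" by simp
    next
      fix s assume "s \<in> set M \<union> set []"
      moreover have "y \<noteq> u" using u(2) Cons by auto
      ultimately show "consistent_triple E {u} u s y"
        using leaf(1)[of s] uM by (auto simp: consistent_triple_def)
    next
      show "distinct ([] @ u # M)" "distinct ([] @ y # Q2')" using dist(1) Cons by simp_all
      show "consistent_list E {u} ([] @ y # Q2')" using Q2(3) Cons by simp
    qed (rule cons_uM)
    then show ?thesis using Cons by simp
  qed
  then have "consistent_list E {u} (rev Q1 @ (u # M @ Q2))"
  proof (intro consistent_list_glue_ends)
    fix r t assume rt: "r \<in> set (rev Q1)" "t \<in> set (u # M @ Q2)" "E r t"
    then have "r \<in> set Q1" "t \<notin> set Q1" "r \<notin> set Q2" using dist(2) by auto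
    then have "t = u" using to_u[of r t] rt(3) by blast
    moreover have "r = hd Q1" using Q1(4) \<open>r \<in> set Q1\<close> rt(3) edge_sym \<open>t = u\<close> by blast
    moreover have "Q1 \<noteq> []" using \<open>r \<in> set Q1\<close> by auto
    ultimately show "r = last (rev Q1) \<and> t = hd (u # M @ Q2)" by (simp add: last_rev)
  next
    show "consistent_list E {u} (rev Q1)" using Q1(3) consistent_list_rev_iff by blast
  qed (use dist in simp_all)
  moreover have "set (rev Q1 @ u # M @ Q2) = insert u (\<Union>w\<in>S. br u w)"
  proof -
    have "S = N1 \<union> set M \<union> N2" using M N1 unfolding N2_def N_def by auto
    moreover have "set M = (\<Union>w\<in>set M. br u w)" using leaf(2) by auto
    ultimately show ?thesis using Q1(2) Q2(2) by auto
  qed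
  ultimately show ?thesis using dist(2) by blast
qed

text \<open>The order is: branch of \<open>x\<close> reversed, \<open>u\<close>, \<open>w\<close>,
  branch of \<open>y\<close>. Only the edge \<open>x w\<close> skips a vertex, namely
  \<open>u\<close>, and \<open>u\<close> alone is in the class of the spine.\<close>

lemma ex_block_fork:
  assumes "E u w" "E w x" "E w y" "x \<noteq> y" "x \<noteq> u" "y \<noteq> u"
    and nbrs: "\<And>z. E w z \<Longrightarrow> z = u \<or> z = x \<or> z = y" and bare: "\<not> med w x" "\<not> med w y"
  shows "\<exists>pre post. distinct (pre @ u # post) \<and>
    set (pre @ u # post) = insert u (br u w) \<and> consistent_list E {u} (pre @ u # post)"
proof -
  obtain Qx where Qx: "distinct (x # Qx)" "set (x # Qx) = br w x" "\<forall>A. consistent_list E A (x # Qx)"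
    using ex_bare_path_list[OF assms(2) bare(1)] by blast
  obtain Qy where Qy: "distinct (y # Qy)" "set (y # Qy) = br w y" "\<forall>A. consistent_list E A (y # Qy)"
    using ex_bare_path_list[OF assms(3) bare(2)] by blast
  have disj: "br w x \<inter> br w y = {}" using br_disjoint assms by blast
  have w: "w \<notin> br w x" "w \<notin> br w y" using root_notin_br assms by auto
  have "{z. E w z \<and> z \<noteq> u} = {x, y}" using nbrs assms by blast
  then have br: "br u w = insert w (br w x \<union> br w y)" using br_unfold[OF assms(1)] by simp
  have u: "u \<notin> br u w" using root_notin_br assms by blast
  have dist: "distinct (rev (x # Qx) @ u # w # y # Qy)"
    using Qx(1,2) Qy(1,2) disj w u br by auto
  have 1: "consistent_list E {u} ([w] @ (y # Qy))"
  proof (rule consistent_list_glue_ends)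
    fix r t assume "r \<in> set [w]" "t \<in> set (y # Qy)" "E r t"
    then have "t \<in> br w y" "r \<notin> br w y" using Qy(2) w by auto
    then show "r = last [w] \<and> t = hd (y # Qy)"
      using br_entry[OF assms(3) _ \<open>E r t\<close>] by simp
  qed (use Qy in auto)
  have 2: "consistent_list E {u} ([u] @ (w # y # Qy))"
  proof (rule consistent_list_glue_ends)
    fix r t assume rt: "r \<in> set [u]" "t \<in> set (w # y # Qy)" "E r t"
    then have "t \<in> br u w" using Qy(2) br by auto
    then show "r = last [u] \<and> t = hd (w # y # Qy)"
      using br_entry[OF assms(1), of t r] rt u by simp
  qed (use 1 dist in auto)
  have "consistent_list E {u} ((rev Qx @ x # []) @ ([u] @ w # y # Qy))"
  proof (rule consistent_list_glue)
    fix r t assume rt: "r \<in> set (rev Qx @ x # [])" "t \<in> set ([u] @ w # y # Qy)" "E r t"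
    then have r: "r \<in> br w x" and "t \<notin> set (x # Qx)" using Qx(2) dist by auto
    from this(2) have "t \<notin> br w x" unfolding Qx(2) .
    then show "r = x \<and> t = w" using br_exit[OF assms(2) r rt(3)] by blast
  next
    fix s assume "s \<in> set [] \<union> set [u]"
    then show "consistent_triple E {u} x s w"
      using assms no_loop by (auto simp: consistent_triple_def)
  next
    show "consistent_list E {u} (rev Qx @ x # [])"
      using Qx(3) consistent_list_rev_iff[of "{u}" "x # Qx"] by simp
  qed (use 2 dist in auto)
  moreover have "set (rev (x # Qx) @ u # w # y # Qy) = insert u (br u w)"
    using Qx(2) Qy(2) br by auto
  ultimately show ?thesis
    using dist by (intro exI[of _ "rev (x # Qx)"] exI[of _ "w # y # Qy"]) simp
qed

end


locale sparse_tree = tree +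
  assumes card_nonleaf_nbrs: "card {u. leg E c u 1 1} \<le> 4"
    and heavy_cases_two: "heavy c u \<Longrightarrow> heavy c v \<Longrightarrow> heavy c w \<Longrightarrow> u = v \<or> v = w \<or> u = w"
    and med_degree_3: "med c u \<Longrightarrow> med c v \<Longrightarrow> med c w \<Longrightarrow> E c x \<Longrightarrow> u \<noteq> v \<Longrightarrow> v \<noteq> w \<Longrightarrow> u \<noteq> w \<Longrightarrow>
      x = u \<or> x = v \<or> x = w"
begin

text \<open>The invariant of the spine: after the step from \<open>c\<close> to \<open>u\<close>, at most one branch at \<open>u\<close>
  needs to be continued along the spine.\<close>

definition spine_step :: "'a \<Rightarrow> 'a \<Rightarrow> bool" where
  "spine_step c u \<longleftrightarrow> E c u \<and>
    (med u c \<and> (\<forall>v w. heavy u v \<and> heavy u w \<and> v \<noteq> c \<and> w \<noteq> c \<longrightarrow> v = w) \<or>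
      (\<forall>w. w \<noteq> c \<longrightarrow> \<not> med u w)) \<and>
    (leg E u c 1 1 \<or> (\<forall>w. w \<noteq> c \<longrightarrow> \<not> leg E u w 1 1))"

text \<open>If the branch back at \<open>u\<close> is medium, the branch back at \<open>v\<close> is
  heavy and leaves room for one further heavy branch. If it is not, no forward branch is medium, and
  this is inherited.\<close>

lemma spine_step_child:
  assumes "spine_step c u" "E u v" "v \<noteq> c"
  shows "spine_step u v"
  unfolding spine_step_def
proof (intro conjI)
  have Ecu: "E c u" using assms unfolding spine_step_def by blast
  show "leg E v u 1 1 \<or> (\<forall>w. w \<noteq> u \<longrightarrow> \<not> leg E v w 1 1)"
    using nonleaf_intro[of v u c] assms Ecu edge_sym by blast
  show "med v u \<and> (\<forall>x w. heavy v x \<and> heavy v w \<and> x \<noteq> u \<and> w \<noteq> u \<longrightarrow> x = w) \<or>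
    (\<forall>w. w \<noteq> u \<longrightarrow> \<not> med v w)"
  proof (cases "med u c")
    case True
    then have "heavy v u" using med_step[of v u c] assms Ecu edge_sym by blast
    then show ?thesis using heavy_imp_med heavy_cases_two by blast
  next
    case False
    then have "\<not> med u v" using assms unfolding spine_step_def by blast
    then have "\<not> med v w" if "w \<noteq> u" for w
      using med_step[OF assms(2) _ that] heavy_imp_med med_edge by blast
    then show ?thesis by blast
  qed
qed (use assms in blast)

text \<open>No branch beside the spine is heavy, since \<open>v\<close> would be a second heavy one.
  If one is medium, so are those at \<open>v\<close> and \<open>c\<close>, the degree is 3, and not
  being heavy leaves a fork. Otherwise all are bare; a non-leaf among them makes \<open>v\<close>
  and \<open>c\<close> non-leaves too, so at most two are longer than one vertex.\<close>

lemma ex_block: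
  assumes spine: "spine_step c u" and v: "E u v" "v \<noteq> c"
    and best: "\<forall>w. w \<noteq> c \<and> heavy u w \<longrightarrow> heavy u v" "\<forall>w. w \<noteq> c \<and> med u w \<longrightarrow> med u v"
      "\<forall>w. w \<noteq> c \<and> leg E u w 1 1 \<longrightarrow> leg E u v 1 1"
  shows "\<exists>pre post. distinct (pre @ u # post) \<and>
    set (pre @ u # post) = insert u (\<Union>w\<in>{w. E u w \<and> w \<noteq> c \<and> w \<noteq> v}. br u w) \<and>
    consistent_list E {u} (pre @ u # post)"
proof -
  define S where "S = {w. E u w \<and> w \<noteq> c \<and> w \<noteq> v}"
  have not_heavy: "\<not> heavy u w" if "w \<in> S" for w
  proof
    assume "heavy u w"
    moreover have "w \<noteq> c" "w \<noteq> v" using that unfolding S_def by auto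
    moreover from calculation have "heavy u v" "med u w" using best(1) heavy_imp_med by blast+
    ultimately show False using spine v(2) unfolding spine_step_def by blast
  qed
  show ?thesis
  proof (cases "\<exists>w\<in>S. med u w")
    case True
    then obtain w where w: "w \<in> S" "med u w" by blast
    then have medv: "med u v" using best(2) unfolding S_def by blast
    have medc: "med u c" using w spine unfolding S_def spine_step_def by blast
    have "x = w" if "x \<in> S" for x
      using med_degree_3[OF w(2) medv medc, of x] that w(1) v unfolding S_def by blast
    then have S: "S = {w}" using w by blast
    have E: "E u w" using w med_edge by blast
    have bare: "\<not> med w x" if "E w x" "x \<noteq> u" for x
      using med_step[OF E that] not_heavy w by blast
    obtain x y where xy: "E w x" "E w y" "x \<noteq> y" "x \<noteq> u" "y \<noteq> u"
      using med_cases[OF w(2)] bare by blast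
    have "z = u \<or> z = x \<or> z = y" if "E w z" for z
      using heavy_tip[OF E xy(1,2) that] not_heavy[OF w(1)] xy by auto
    then show ?thesis
      using ex_block_fork[OF E xy] bare xy unfolding S_def[symmetric] S by simp
  next
    case False
    have "card {w \<in> S. leg E u w 1 1} \<le> 2"
    proof (cases "{w \<in> S. leg E u w 1 1} = {}")
      case True
      then show ?thesis by (simp only: card.empty)
    next
      case False
      then have "leg E u v 1 1" "leg E u c 1 1"
        using best(3) spine unfolding S_def spine_step_def by blast+
      then have sub: "insert v (insert c {w \<in> S. leg E u w 1 1}) \<subseteq> {w. leg E u w 1 1}" by blast
      have "{w. leg E u w 1 1} \<subseteq> V" by (auto dest!: leg_edge dest: edge_in)
      then have fin: "finite {w. leg E u w 1 1}" by (rule finite_subset[OF _ finite_V])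
      have "finite {w \<in> S. leg E u w 1 1}" by (rule finite_subset[OF _ fin]) blast
      moreover have "v \<notin> insert c {w \<in> S. leg E u w 1 1}" "c \<notin> {w \<in> S. leg E u w 1 1}"
        using v unfolding S_def by auto
      ultimately have "card (insert v (insert c {w \<in> S. leg E u w 1 1})) =
          Suc (Suc (card {w \<in> S. leg E u w 1 1}))" by simp
      then show ?thesis using card_mono[OF fin sub] card_nonleaf_nbrs[of u] by linarith
    qed
    then show ?thesis
      using ex_block_bare[of S u] False unfolding S_def[symmetric] unfolding S_def by blast
  qed
qed

text \<open>The conditions on \<open>A\<close> prepare the next gluing: \<open>u\<close> is on the
  spine and everything listed in front of it is not, so nothing of the class separates
  \<open>u\<close> from its predecessor.\<close>

lemma ex_branch_list:
  assumes "spine_step c u"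
  shows "\<exists>A pre post. distinct (pre @ u # post) \<and> set (pre @ u # post) = br c u \<and>
    consistent_list E A (pre @ u # post) \<and> u \<in> A \<and> A \<inter> set pre = {}"
  using assms
proof (induction "card (br c u)" arbitrary: c u rule: less_induct)
  case less
  have E: "E c u" using less.prems unfolding spine_step_def by blast
  show ?case
  proof (cases "\<exists>v. E u v \<and> v \<noteq> c")
    case False
    then have no_child: "{v. E u v \<and> v \<noteq> c} = {}" by blast
    have "br c u = {u}" unfolding br_unfold[OF E] no_child by simp
    then show ?thesis by (intro exI[of _ "{u}"] exI[of _ "[]"]) simp
  next
    case True
    \<comment> \<open>Heavy implies medium and medium implies non-leaf, so a neighbour of the
      highest rank present satisfies all three conditions at once.\<close>
    have "\<exists>v. E u v \<and> v \<noteq> c \<and> (\<forall>w. w \<noteq> c \<and> heavy u w \<longrightarrow> heavy u v) \<and>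
      (\<forall>w. w \<noteq> c \<and> med u w \<longrightarrow> med u v) \<and> (\<forall>w. w \<noteq> c \<and> leg E u w 1 1 \<longrightarrow> leg E u v 1 1)"
      using True heavy_imp_med med_imp_nonleaf med_edge leg_edge[of E u _ 1 1] by metis
    then obtain v where v: "E u v" "v \<noteq> c" "\<forall>w. w \<noteq> c \<and> heavy u w \<longrightarrow> heavy u v"
      "\<forall>w. w \<noteq> c \<and> med u w \<longrightarrow> med u v" "\<forall>w. w \<noteq> c \<and> leg E u w 1 1 \<longrightarrow> leg E u v 1 1"
      by (elim exE conjE)
    obtain pre1 post1 where K: "distinct (pre1 @ u # post1)"
      "set (pre1 @ u # post1) = insert u (\<Union>w\<in>{w. E u w \<and> w \<noteq> c \<and> w \<noteq> v}. br u w)"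
      "consistent_list E {u} (pre1 @ u # post1)"
      using ex_block[OF less.prems v] by blast
    obtain A pre2 post2 where L: "distinct (pre2 @ v # post2)" "set (pre2 @ v # post2) = br u v"
      "consistent_list E A (pre2 @ v # post2)" "v \<in> A" "A \<inter> set pre2 = {}"
      using less.hyps[OF br_psubset[OF E v(1,2)] spine_step_child[OF less.prems v(1,2)]] by blast
    let ?K = "pre1 @ u # post1" and ?L = "pre2 @ v # post2"
    define B where "B = insert u (A \<inter> br u v)"
    have u: "u \<notin> br u v" using root_notin_br v by blast
    have disj: "set ?K \<inter> set ?L = {}"
      unfolding K(2) L(2) using u br_disjoint[OF _ v(1)] by blast
    have edge: "r = u \<and> t = v" if "r \<in> set ?K" "t \<in> set ?L" "E r t" for r t
    proof -
      have "r \<notin> br u v" "t \<in> br u v" using that(1,2) disj unfolding L(2) by blast+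
      then show ?thesis using br_entry[OF v(1) _ that(3)] by blast
    qed
    have "consistent_list E B (?K @ ?L)"
    proof (rule consistent_list_glue)
      have "{u} \<inter> set ?K = B \<inter> set ?K" using disj unfolding L(2) B_def by auto
      then show "consistent_list E B ?K" using consistent_list_cong K(3) by blast
      have "A \<inter> set ?L = B \<inter> set ?L" using u unfolding L(2) B_def by blast
      then show "consistent_list E B ?L" using consistent_list_cong L(3) by blast
      fix s assume "s \<in> set post1 \<union> set pre2"
      then have "s \<notin> B" using disj K(1) L(5) unfolding L(2)[symmetric] B_def by auto
      moreover have "u \<in> B" "v \<in> B" using L(4) unfolding B_def by auto
      ultimately show "consistent_triple E B u s v" unfolding consistent_triple_def by blast
    qed (use K(1) L(1) edge in blast)+
    moreover have "{w. E u w \<and> w \<noteq> c} = insert v {w. E u w \<and> w \<noteq> c \<and> w \<noteq> v}" using v by blast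
    then have "set (?K @ ?L) = br c u"
      unfolding br_unfold[OF E] set_append[of ?K] K(2) L(2) by auto
    moreover have "distinct (?K @ ?L)" using K(1) L(1) disj by (simp only: distinct_append)
    moreover have "u \<in> B" "B \<inter> set pre1 = {}"
      using K(1) disj unfolding B_def L(2)[symmetric] by auto
    ultimately show ?thesis
      by (intro exI[of _ B] exI[of _ pre1] exI[of _ "post1 @ ?L"]) simp
  qed
qed

text \<open>The two halves of the spine start at the ends of one edge; one list is reversed so that
  the halves extend in opposite directions.\<close>

lemma spine_steps_imp_ordering:
  assumes "spine_step v u" "spine_step u v"
  shows "two_class_ordering V E"
proof -
  obtain A1 pre1 post1 where K: "distinct (pre1 @ u # post1)" "set (pre1 @ u # post1) = br v u"
    "consistent_list E A1 (pre1 @ u # post1)" "u \<in> A1" "A1 \<inter> set pre1 = {}"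
    using ex_branch_list[OF assms(1)] by blast
  obtain A2 pre2 post2 where L: "distinct (pre2 @ v # post2)" "set (pre2 @ v # post2) = br u v"
    "consistent_list E A2 (pre2 @ v # post2)" "v \<in> A2" "A2 \<inter> set pre2 = {}"
    using ex_branch_list[OF assms(2)] by blast
  have E: "E u v" using assms unfolding spine_step_def by blast
  note split = br_edge_split[OF E]
  define B where "B = (A1 \<inter> br v u) \<union> (A2 \<inter> br u v)"
  let ?K = "rev post1 @ u # rev pre1" and ?L = "pre2 @ v # post2"
  have setK: "set ?K = br v u" using K(2) by auto
  have "consistent_list E B (?K @ ?L)"
  proof (rule consistent_list_glue)
    have "consistent_list E A1 ?K"
      using K(3) consistent_list_rev_iff[of A1 "pre1 @ u # post1"] by simp
    moreover have "A1 \<inter> set ?K = B \<inter> set ?K" using split(1) unfolding setK B_def by blast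
    ultimately show "consistent_list E B ?K" using consistent_list_cong by blast
    have "A2 \<inter> set ?L = B \<inter> set ?L" using split(1) unfolding L(2) B_def by blast
    then show "consistent_list E B ?L" using consistent_list_cong L(3) by blast
    show "distinct ?K" using K(1) by auto
    fix r t assume "r \<in> set ?K" "t \<in> set ?L" "E r t"
    then have "t \<in> br u v" "r \<notin> br u v" using split(1) unfolding setK L(2) by blast+
    then show "r = u \<and> t = v" using br_entry[OF E _ \<open>E r t\<close>] by blast
  next
    have "u \<in> B" "v \<in> B" using K(4) L(4) unfolding B_def by auto
    moreover fix s assume s: "s \<in> set (rev pre1) \<union> set pre2"
    have "s \<notin> B"
    proof (cases "s \<in> set pre1")
      case True
      then have "s \<in> br v u" unfolding K(2)[symmetric] by simp
      then show ?thesis using split(1) K(5) True unfolding B_def by blast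
    next
      case False
      then have "s \<in> set pre2" using s by simp
      then have "s \<in> br u v" unfolding L(2)[symmetric] by simp
      then show ?thesis using split(1) L(5) \<open>s \<in> set pre2\<close> unfolding B_def by blast
    qed
    ultimately show "consistent_triple E B u s v" unfolding consistent_triple_def by blast
  qed (rule L(1))
  moreover have "distinct (?K @ ?L)"
    using K(1) L(1) split(1) setK L(2) by (simp only: distinct_append) auto
  moreover have "set (?K @ ?L) = V" unfolding set_append[of ?K] setK L(2) using split(2) by blast
  ultimately obtain ord where
    "inj_on ord V" "strongly_consistent V E ord (\<lambda>x. if x \<in> B then 0 else 1)"
    using consistent_list_imp_ordering by blast
  then show ?thesis
    unfolding two_class_ordering_def by (intro exI[of _ ord] exI[of _ "\<lambda>x. if x \<in> B then 0 else 1"]) auto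
qed

text \<open>The first edge must satisfy the invariant in both directions: it enters one of two heavy
  branches at a vertex, or else it is medium from both ends, or else it leaves a vertex of degree at
  least 3.\<close>

lemma ex_two_class_ordering:
  assumes "E r a" "E r b" "E r d" "distinct [a, b, d]"
  shows "two_class_ordering V E"
proof -
  have nonleaf_sym: "leg E v u 1 1" if "med u v" "E u w" "w \<noteq> v" for u v w
    using nonleaf_intro[of v u w] that med_edge edge_sym by blast
  consider (heavy) u v w where "heavy u v" "heavy u w" "v \<noteq> w"
    | (med) u v where "med u v" "med v u" "\<And>u v w. heavy u v \<Longrightarrow> heavy u w \<Longrightarrow> v = w"
    | (bare) "\<And>u v. med u v \<Longrightarrow> \<not> med v u"
    by blast
  then show ?thesis
  proof cases
    case heavy
    have E: "E u v" "E v u" "E u w" using heavy heavy_imp_med med_edge edge_sym by blast+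
    have "heavy v u" using med_step[OF E(2,3)] heavy heavy_imp_med by blast
    moreover have "leg E u v 1 1" using heavy heavy_imp_med med_imp_nonleaf by blast
    moreover have "leg E v u 1 1" using nonleaf_intro[OF E(2,3)] heavy by blast
    ultimately have "spine_step v u" "spine_step u v"
      unfolding spine_step_def using E heavy heavy_imp_med heavy_cases_two by blast+
    then show ?thesis by (rule spine_steps_imp_ordering)
  next
    case med
    then have "spine_step v u" "spine_step u v"
      unfolding spine_step_def using med_edge med_imp_nonleaf by blast+
    then show ?thesis by (rule spine_steps_imp_ordering)
  next
    case bare
    \<comment> \<open>Two of the three given neighbours of \<open>r\<close> differ from
      \<open>w\<close>. As no edge is medium both ways here, no branch at \<open>r\<close> is
      medium; it remains to prefer a non-leaf neighbour.\<close>
    have "med w r" if "E r w" for w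
      using med_tip[of w r] that assms edge_sym by (metis distinct_length_2_or_more)
    then have r: "\<not> med r w" for w using bare med_edge by blast
    obtain v where v: "E r v" "leg E r v 1 1 \<or> (\<forall>w. \<not> leg E r w 1 1)"
      using assms(1) leg_edge[of E r _ 1 1] by blast
    have "leg E v r 1 1"
      using nonleaf_intro[of v r] v(1) edge_sym assms by (metis distinct_length_2_or_more)
    moreover have "\<not> med v w" if "w \<noteq> r" for w
      using med_step[OF v(1) _ that] r heavy_imp_med med_edge by blast
    ultimately have "spine_step v r" "spine_step r v"
      unfolding spine_step_def using v r edge_sym by blast+
    then show ?thesis by (rule spine_steps_imp_ordering)
  qed
qed

end


section \<open>Spiders as the only obstructions\<close>

context tree
begin

lemma legs3_has_spider:
  assumes "leg E c u i m" "leg E c v j n" "leg E c w k p" "u \<noteq> v" "v \<noteq> w" "u \<noteq> w"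
  shows "has_spider V E [(i, m), (j, n), (k, p)]"
proof (rule legs_has_spider[of c "[u, v, w]"])
  show "c \<in> V" using leg_edge[OF assms(1)] edge_in by blast
  fix b assume "b < length [(i, m), (j, n), (k, p)]"
  then have "b = 0 \<or> b = 1 \<or> b = 2" by auto
  then show "leg E c ([u, v, w] ! b) (fst ([(i, m), (j, n), (k, p)] ! b)) (snd ([(i, m), (j, n), (k, p)] ! b))"
    using assms(1-3) by (elim disjE) simp_all
qed (use assms in auto)

lemma leaf_legs3_has_T5:
  assumes "E c x" "leg E c u 1 2" "leg E c v i 2" "leg E c w j 2" "distinct [x, u, v, w]"
  shows "has_spider V E (T5 i j)"
proof (rule legs_has_spider[of c "[x, u, v, w]"])
  show "c \<in> V" using assms(1) edge_in by blast
  have "leg E c x 1 0" using leg.tip[of E c x "{}" 0] assms(1) by simp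
  moreover fix b assume "b < length (T5 i j)"
  then have "b = 0 \<or> b = 1 \<or> b = 2 \<or> b = 3" by (auto simp: T5_def)
  ultimately show "leg E c ([x, u, v, w] ! b) (fst (T5 i j ! b)) (snd (T5 i j ! b))"
    using assms(2-4) unfolding T5_def by (elim disjE) simp_all
qed (use assms in \<open>simp_all add: T5_def\<close>)

lemma no_spiders_imp_sparse_tree:
  assumes T0: "\<not> has_spider V E T0"
    and T1: "\<not> has_spider V E T1"
    and T2: "\<And>i j k. 2 \<le> i \<Longrightarrow> 2 \<le> j \<Longrightarrow> 2 \<le> k \<Longrightarrow> \<not> has_spider V E (T2 i j k)"
    and T3: "\<And>i j. 2 \<le> i \<Longrightarrow> 2 \<le> j \<Longrightarrow> \<not> has_spider V E (T3 i j)"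
    and T4: "\<And>i. 2 \<le> i \<Longrightarrow> \<not> has_spider V E (T4 i)"
    and T5: "\<And>i j. 1 \<le> i \<Longrightarrow> 1 \<le> j \<Longrightarrow> \<not> has_spider V E (T5 i j)"
  shows "sparse_tree V E"
proof
  fix c
  show "card {u. leg E c u 1 1} \<le> 4"
  proof (rule ccontr)
    assume "\<not> ?thesis"
    then have "5 \<le> card {u. leg E c u 1 1}" by simp
    then obtain S where S: "S \<subseteq> {u. leg E c u 1 1}" "card S = 5" "finite S"
      by (metis obtain_subset_with_card_n)
    then obtain us where us: "set us = S" "distinct us" using finite_distinct_list by blast
    have len: "length us = 5" using us S(2) by (metis distinct_card)
    have "us \<noteq> []" using len by auto
    then have "leg E c (hd us) 1 1" using us(1) S(1) hd_in_set[of us] by blast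
    then have "E c (hd us)" by (rule leg_edge)
    then have "c \<in> V" by (rule edge_in(1))
    moreover have "leg E c (us ! b) (fst (T0 ! b)) (snd (T0 ! b))" if "b < length T0" for b
    proof -
      have "us ! b \<in> S" using that len us(1) by (auto simp: T0_def)
      then have "leg E c (us ! b) 1 1" using S(1) by blast
      then show ?thesis using that by (simp add: T0_def)
    qed
    ultimately show False using T0 legs_has_spider[of c us T0] us(2) len by (simp add: T0_def)
  qed
next
  fix c u v w
  have T1_eq: "T1 = [(1, 3), (1, 3), (1, 3)]" by (simp add: T1_def numeral_3_eq_3)
  \<comment> \<open>The four exclusions are stated for all triples because the kinds of the legs may
    be permuted.\<close>
  have no1: "\<not> (leg E c u 1 3 \<and> leg E c v 1 3 \<and> leg E c w 1 3)"
    if "u \<noteq> v" "v \<noteq> w" "u \<noteq> w" for u v w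
    using legs3_has_spider[OF _ _ _ that] T1 unfolding T1_eq by blast
  have no2: "\<not> (2 \<le> i \<and> leg E c u i 2 \<and> 2 \<le> j \<and> leg E c v j 2 \<and> 2 \<le> k \<and> leg E c w k 2)"
    if "u \<noteq> v" "v \<noteq> w" "u \<noteq> w" for u v w i j k
    using legs3_has_spider[OF _ _ _ that] T2[unfolded T2_def] by blast
  have no3: "\<not> (leg E c u 1 3 \<and> 2 \<le> j \<and> leg E c v j 2 \<and> 2 \<le> k \<and> leg E c w k 2)"
    if "u \<noteq> v" "v \<noteq> w" "u \<noteq> w" for u v w j k
    using legs3_has_spider[OF _ _ _ that] T3[unfolded T3_def] by blast
  have no4: "\<not> (leg E c u 1 3 \<and> leg E c v 1 3 \<and> 2 \<le> k \<and> leg E c w k 2)"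
    if "u \<noteq> v" "v \<noteq> w" "u \<noteq> w" for u v w k
    using legs3_has_spider[OF _ _ _ that] T4[unfolded T4_def] by blast
  show "u = v \<or> v = w \<or> u = w" if "heavy c u" "heavy c v" "heavy c w"
  proof (rule ccontr)
    assume "\<not> ?thesis"
    then have ne: "u \<noteq> v" "v \<noteq> w" "u \<noteq> w" "v \<noteq> u" "w \<noteq> v" "w \<noteq> u" by auto
    define L where "L z \<longleftrightarrow> (\<exists>i\<ge>2. leg E c z i 2)" for z
    have "leg E c u 1 3 \<or> L u" "leg E c v 1 3 \<or> L v" "leg E c w 1 3 \<or> L w"
      using that unfolding heavy_def L_def by auto
    moreover have "\<not> (leg E c u 1 3 \<and> leg E c v 1 3 \<and> leg E c w 1 3)"
      using no1 ne by blast
    moreover have "\<not> (L u \<and> L v \<and> L w)"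
      unfolding L_def using no2[OF ne(1-3)] by blast
    moreover have "\<not> (leg E c u 1 3 \<and> L v \<and> L w)" "\<not> (leg E c v 1 3 \<and> L u \<and> L w)"
      "\<not> (leg E c w 1 3 \<and> L u \<and> L v)"
      unfolding L_def using no3[of u v w] no3[of v u w] no3[of w u v] ne by blast+
    moreover have "\<not> (leg E c u 1 3 \<and> leg E c v 1 3 \<and> L w)" "\<not> (leg E c u 1 3 \<and> leg E c w 1 3 \<and> L v)"
      "\<not> (leg E c v 1 3 \<and> leg E c w 1 3 \<and> L u)"
      unfolding L_def using no4[of u v w] no4[of u w v] no4[of v w u] ne by blast+
    ultimately show False by blast
  qed
  fix x
  show "x = u \<or> x = v \<or> x = w"
    if med: "med c u" "med c v" "med c w" and Ecx: "E c x" and ne: "u \<noteq> v" "v \<noteq> w" "u \<noteq> w"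
  proof (rule ccontr)
    assume x: "\<not> ?thesis"
    obtain i j k where ijk: "leg E c u i 2" "leg E c v j 2" "leg E c w k 2"
      using med unfolding med_def by blast
    have pos: "1 \<le> i" "1 \<le> j" "1 \<le> k"
      using ijk[THEN leg_pos] by (simp_all add: Suc_le_eq)
    \<comment> \<open>A leg of length 1 would serve as the short fork of \<open>T5\<close>, with
      \<open>x\<close> as its leaf; with all three longer, \<open>T2\<close> appears.\<close>
    have "i \<noteq> 1"
      using leaf_legs3_has_T5[OF Ecx _ ijk(2,3), of u] T5[OF pos(2,3)] ijk(1) x ne by auto
    moreover have "j \<noteq> 1"
      using leaf_legs3_has_T5[OF Ecx _ ijk(1,3), of v] T5[OF pos(1,3)] ijk(2) x ne by auto
    moreover have "k \<noteq> 1"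
      using leaf_legs3_has_T5[OF Ecx _ ijk(1,2), of w] T5[OF pos(1,2)] ijk(3) x ne by auto
    ultimately have "2 \<le> i" "2 \<le> j" "2 \<le> k" using pos by linarith+
    then show False using no2[OF ne, of i j k] ijk by blast
  qed
qed

section \<open>Degree three and the value of the proper thinness\<close>

lemma degree_ge_3_iff:
  "3 \<le> degree V E r \<longleftrightarrow> (\<exists>a b d. E r a \<and> E r b \<and> E r d \<and> distinct [a, b, d])"
proof
  assume "3 \<le> degree V E r"
  then obtain S where "S \<subseteq> {u \<in> V. E r u}" "card S = 3"
    unfolding degree_def by (metis obtain_subset_with_card_n)
  then show "\<exists>a b d. E r a \<and> E r b \<and> E r d \<and> distinct [a, b, d]"
    by (auto simp: card_3_iff)
next
  assume "\<exists>a b d. E r a \<and> E r b \<and> E r d \<and> distinct [a, b, d]"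
  then obtain a b d where abd: "E r a" "E r b" "E r d" "distinct [a, b, d]" by blast
  then have "card {a, b, d} \<le> card {u \<in> V. E r u}"
    using finite_V edge_in by (intro card_mono) auto
  then show "3 \<le> degree V E r" using abd(4) unfolding degree_def by simp
qed

text \<open>In a single class a vertex has at most one neighbour on each side.\<close>

lemma one_class_ordering_imp_path:
  assumes "inj_on ord V" "cls ` V \<subseteq> {..<1}" "strongly_consistent V E ord cls"
  shows "degree V E r < 3"
proof (rule ccontr)
  assume "\<not> degree V E r < 3"
  then obtain a b d where abd: "E r a" "E r b" "E r d" "distinct [a, b, d]"
    using degree_ge_3_iff[of r] by auto
  have "cls x = 0" if "x \<in> V" for x using assms(2) that by (simp add: image_subset_iff)
  then interpret strip V E "\<lambda>x. int (ord x)" "\<lambda>_. True"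
    by (intro strip_of_ordering[OF assms(1,3)]) simp
  have "x = y" if "E r x" "E r y" "int (ord r) < int (ord x) \<longleftrightarrow> int (ord r) < int (ord y)" for x y
  proof (cases "int (ord r) < int (ord x)")
    case True
    show ?thesis by (rule same_right_unique[OF that(1,2)]) (use True that(3) in simp_all)
  next
    case False
    moreover have "\<not> int (ord r) < int (ord y)" using False that(3) by simp
    ultimately have "int (ord x) < int (ord r)" "int (ord y) < int (ord r)"
      using same_nbr_side[OF that(1)] same_nbr_side[OF that(2)] by blast+
    then show ?thesis by (intro same_left_unique[OF that(1,2)]) simp_all
  qed
  then show False using abd by (metis distinct_length_2_or_more)
qed

text \<open>A medium branch contains a vertex of degree 3, so both sides of any edge are bare
  paths.\<close>

lemma path_imp_one_class_ordering:
  assumes "\<And>r. degree V E r < 3"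
  shows "\<exists>ord cls. inj_on ord V \<and> cls ` V \<subseteq> {..<1::nat} \<and> strongly_consistent V E ord cls"
proof -
  have bare: "\<not> med c u" for c u
  proof
    assume "med c u"
    then show False
    proof (induction rule: med_induct)
      case (tip c u x y)
      then have "3 \<le> degree V E u"
        unfolding degree_ge_3_iff by (intro exI[of _ c] exI[of _ x] exI[of _ y]) (auto dest: edge_sym)
      then show ?case using assms[of u] by simp
    qed
  qed
  have "\<exists>L. distinct L \<and> set L = V \<and> consistent_list E UNIV L"
  proof (cases "\<exists>u v. E u v")
    case False
    obtain L where L: "set L = V" "distinct L" using finite_distinct_list[OF finite_V] by blast
    moreover have "consistent_list E UNIV L"
      by (rule consistent_list_no_edges) (use False in blast)
    ultimately show ?thesis by blast
  next
    case True
    then obtain u v where E: "E u v" "E v u" using edge_sym by blast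
    obtain Qu where Qu: "distinct (u # Qu)" "set (u # Qu) = br v u" "\<forall>A. consistent_list E A (u # Qu)"
      using ex_bare_path_list[OF E(2) bare] by blast
    obtain Qv where Qv: "distinct (v # Qv)" "set (v # Qv) = br u v" "\<forall>A. consistent_list E A (v # Qv)"
      using ex_bare_path_list[OF E(1) bare] by blast
    note split = br_edge_split[OF E(1)]
    have "consistent_list E UNIV (rev (u # Qu) @ (v # Qv))"
    proof (rule consistent_list_glue_ends)
      show "consistent_list E UNIV (rev (u # Qu))"
        using Qu(3) consistent_list_rev_iff by blast
      fix r t assume rt: "r \<in> set (rev (u # Qu))" "t \<in> set (v # Qv)" "E r t"
      then have "r \<notin> br u v" "t \<in> br u v" using split(1) unfolding set_rev Qu(2) Qv(2) by blast+
      then have "r = u \<and> t = v" using br_entry[OF E(1) _ rt(3)] by blast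
      then show "r = last (rev (u # Qu)) \<and> t = hd (v # Qv)" by simp
    qed (use Qu(1) Qv in auto)
    moreover have "set (rev (u # Qu) @ (v # Qv)) = V"
      unfolding set_append set_rev Qu(2) Qv(2) using split(2) by blast
    moreover have "distinct (rev (u # Qu) @ (v # Qv))"
      unfolding distinct_append distinct_rev set_rev Qu(2) Qv(2) using Qu(1) Qv(1) split(1) by blast
    ultimately show ?thesis by blast
  qed
  then obtain ord where
    ord: "inj_on ord V" "strongly_consistent V E ord (\<lambda>x. if x \<in> UNIV then 0 else 1)"
    using consistent_list_imp_ordering by blast
  moreover have "(\<lambda>x. if x \<in> UNIV then 0 else 1) ` V \<subseteq> {..<1::nat}" by auto
  ultimately show ?thesis by blast
qed

text \<open>Singleton classes are always consistent; this makes the minimum in \<open>pthin\<close>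
  attained.\<close>

lemma ex_ordering:
  "\<exists>k ord cls. inj_on ord V \<and> cls ` V \<subseteq> {..<k::nat} \<and> strongly_consistent V E ord cls"
proof -
  obtain f :: "'a \<Rightarrow> nat" and n where f: "f ` V = {i. i < n}" "inj_on f V"
    using finite_imp_inj_to_nat_seg[OF finite_V] by blast
  have "strongly_consistent V E f f"
    unfolding strongly_consistent_def by auto
  then show ?thesis using f by (intro exI[of _ n] exI[of _ f]) auto
qed

lemma pthin_eq_2_iff:
  "pthin V E = 2 \<longleftrightarrow> two_class_ordering V E \<and> (\<exists>r\<in>V. 3 \<le> degree V E r)"
proof -
  define P where "P k \<longleftrightarrow>
    (\<exists>ord cls. inj_on ord V \<and> cls ` V \<subseteq> {..<k} \<and> strongly_consistent V E ord cls)" for k :: nat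
  have pthin: "pthin V E = (LEAST k. P k)" unfolding pthin_def P_def ..
  have two: "two_class_ordering V E \<longleftrightarrow> P 2" unfolding two_class_ordering_def P_def ..
  have "\<exists>k. P k" using ex_ordering unfolding P_def .
  have P0: "\<not> P 0" using V_nonempty unfolding P_def by auto
  have "r \<in> V" if "3 \<le> degree V E r" for r
    using that edge_in unfolding degree_ge_3_iff by blast
  then have P1: "P 1 \<longleftrightarrow> \<not> (\<exists>r\<in>V. 3 \<le> degree V E r)"
    using one_class_ordering_imp_path path_imp_one_class_ordering unfolding P_def
    by (meson linorder_not_le)
  show ?thesis
  proof
    assume "pthin V E = 2"
    then have least: "(LEAST k. P k) = 2" using pthin by simp
    have "P (LEAST k. P k)" using \<open>\<exists>k. P k\<close> by (rule LeastI_ex)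
    then have "P 2" unfolding least .
    moreover have "\<not> P 1" using not_less_Least[of 1 P] least by simp
    ultimately show "two_class_ordering V E \<and> (\<exists>r\<in>V. 3 \<le> degree V E r)"
      using two P1 by blast
  next
    assume "two_class_ordering V E \<and> (\<exists>r\<in>V. 3 \<le> degree V E r)"
    then have "P 2" "\<not> P 1" using two P1 by blast+
    have "(LEAST k. P k) = 2"
    proof (rule Least_equality)
      fix k assume "P k"
      then have "k \<noteq> 0" "k \<noteq> 1" using P0 \<open>\<not> P 1\<close> by metis+
      then show "2 \<le> k" by simp
    qed (rule \<open>P 2\<close>)
    then show "pthin V E = 2" using pthin by simp
  qed
qed

end


theorem theorem4:
  fixes V :: "'a set" and E :: "'a \<Rightarrow> 'a \<Rightarrow> bool"
  assumes "is_tree V E"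
  shows "pthin V E = 2 \<longleftrightarrow>
    (\<exists>v\<in>V. degree V E v \<ge> 3) \<and>
    \<not> has_spider V E T0 \<and>
    \<not> has_spider V E T1 \<and>
    (\<forall>i j k. 2 \<le> i \<and> 2 \<le> j \<and> 2 \<le> k \<longrightarrow> \<not> has_spider V E (T2 i j k)) \<and>
    (\<forall>i j. 2 \<le> i \<and> 2 \<le> j \<longrightarrow> \<not> has_spider V E (T3 i j)) \<and>
    (\<forall>i. 2 \<le> i \<longrightarrow> \<not> has_spider V E (T4 i)) \<and>
    (\<forall>i j. 1 \<le> i \<and> 1 \<le> j \<longrightarrow> \<not> has_spider V E (T5 i j))"
proof -
  interpret tree V E using assms by unfold_locales
  show ?thesis
    unfolding pthin_eq_2_iff
  proof (intro iffI conjI allI impI; (elim conjE)?)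
    assume two: "two_class_ordering V E"
    show "\<not> has_spider V E T0" "\<not> has_spider V E T1"
      "\<And>i j k. 2 \<le> i \<Longrightarrow> 2 \<le> j \<Longrightarrow> 2 \<le> k \<Longrightarrow> \<not> has_spider V E (T2 i j k)"
      "\<And>i j. 2 \<le> i \<Longrightarrow> 2 \<le> j \<Longrightarrow> \<not> has_spider V E (T3 i j)"
      "\<And>i. 2 \<le> i \<Longrightarrow> \<not> has_spider V E (T4 i)"
      "\<And>i j. 1 \<le> i \<Longrightarrow> 1 \<le> j \<Longrightarrow> \<not> has_spider V E (T5 i j)"
      using two_class_ordering_no_spiders[OF two] by blast+
  next
    assume "\<exists>v\<in>V. 3 \<le> degree V E v" "\<not> has_spider V E T0" "\<not> has_spider V E T1"
      "\<forall>i j k. 2 \<le> i \<and> 2 \<le> j \<and> 2 \<le> k \<longrightarrow> \<not> has_spider V E (T2 i j k)"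
      "\<forall>i j. 2 \<le> i \<and> 2 \<le> j \<longrightarrow> \<not> has_spider V E (T3 i j)"
      "\<forall>i. 2 \<le> i \<longrightarrow> \<not> has_spider V E (T4 i)"
      "\<forall>i j. 1 \<le> i \<and> 1 \<le> j \<longrightarrow> \<not> has_spider V E (T5 i j)"
    then interpret sparse_tree V E by (intro no_spiders_imp_sparse_tree) blast+
    show "two_class_ordering V E"
      using \<open>\<exists>v\<in>V. 3 \<le> degree V E v\<close> ex_two_class_ordering degree_ge_3_iff by blast
  qed
qed

end
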